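(* Let $m,k\in\mathbb N$ and $\lambda:m\to k$ a function, and for $i\in k$ let $T_i$ be a finite rooted tree. Let $c$ be a finite coloring of $\mathrm{FIN}^{T_{\lambda(0)}}\times\cdots\times\mathrm{FIN}^{T_{\lambda(m-1)}}$. For every sequence $(d_n)_{n\in\omega}$ in $\omega$ there exist sequences $(b_{i,t,n})_{n\in\omega}$ in $\mathrm{FIN}^{T_i}_t$, for $i\in k$ and $t\in T_i$, such that: (a) $\mathrm{dom}(b_{i,t,n})>d_n$ and $\mathrm{dom}(b_{i,t,n+1})>\mathrm{dom}(b_{i,t,n})$ for every $i\in k$, $t\in T_i$, $n\in\omega$; (b) for all finite nonempty $F_0<F_1<\cdots<F_{m-1}$ in $\omega$, nodes $t_{i,d}\in T_i$ and regressive homomorphisms $f_{i,d}$ of $T_i$ ($i\in k$, $d\in\omega$) such that for every $s\in m$ the set $\{f_{\lambda(s),d}(t_{\lambda(s),d}):d\in F_s\}$ is a chain in $T_{\lambda(s)}$ with least element $t_s$, the color of $$\Big(\sum_{d\in F_s}\tau_{f_{\lambda(s),d}}\big(b_{\lambda(s),t_{\lambda(s),d},d}\big)\Big)_{s\in m}$$ depends only on $(t_s)_{s\in m}$.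
   Context: $\omega=\{0,1,\dots\}$. For finite $A,B\subseteq\omega$ and $d\in\omega$, $A>d$ means every element of $A$ exceeds $d$, $B>A$ means every element of $B$ exceeds every element of $A$ (vacuous for empty sets); for nonempty $A,B$, $A<B$ means $\max A<\min B$. Finite rooted tree $T$ with root $r$, ordered by $t'\le t$ iff $t'$ is a descendant of or equal to $t$; $T^+=T\setminus\{r\}$. Regressive homomorphism: $f:T\to T$ with $f(t)\ge t$ mapping adjacent nodes to equal or adjacent nodes. $\mathrm{FIN}^T$: functions $b:\mathrm{dom}(b)\to T^+$, $\mathrm{dom}(b)\subseteq\omega$ finite (possibly empty), range in a branch of $T$; $b_0+b_1$ is defined iff domains are disjoint, and equals $b_0\cup b_1$. $\mathrm{FIN}^T_t$ ($t\in T^+$): those $b$ whose range is a chain with least element $t$; $\mathrm{FIN}^T_r=\{\emptyset\}$. $\tau_f(b)$: domain $\{n\in\mathrm{dom}(b):f(b(n))\in T^+\}$, $n\mapsto f(b(n))$. The sums $\sum_{d\in F_s}$ are taken in $\mathrm{FIN}^{T_{\lambda(s)}}$ (in increasing order of $d$), and writing them asserts they are defined.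
   Formalization: Regressive homomorphisms are also required to preserve the tree order (u ≤ v implies f(u) ≤ f(v)); without this the claim fails, e.g. for the path r > p > q with f fixing r and p and sending q to r. *)

theory Defs
  imports Main "HOL-Library.FuncSet"
begin

text \<open>A rooted tree is given by its nodes, its root and the set of pairs
  (child, parent).\<close>

record 'a rtree =
  nodes :: "'a set"
  root :: 'a
  parent :: "('a \<times> 'a) set"

definition finite_rooted_tree :: "'a rtree \<Rightarrow> bool" where
  "finite_rooted_tree T \<longleftrightarrow>
     finite (nodes T) \<and> root T \<in> nodes T \<and> parent T \<subseteq> nodes T \<times> nodes T \<and>
     (\<forall>p. (root T, p) \<notin> parent T) \<and>
     (\<forall>t \<in> nodes T - {root T}. \<exists>!p. (t, p) \<in> parent T) \<and>
     (\<forall>t \<in> nodes T. (t, root T) \<in> (parent T)\<^sup>*)"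

definition tle :: "'a rtree \<Rightarrow> 'a \<Rightarrow> 'a \<Rightarrow> bool" where
  "tle T t' t \<longleftrightarrow> (t', t) \<in> (parent T)\<^sup>*"

definition adjacent :: "'a rtree \<Rightarrow> 'a \<Rightarrow> 'a \<Rightarrow> bool" where
  "adjacent T u v \<longleftrightarrow> (u, v) \<in> parent T \<or> (v, u) \<in> parent T"

definition plus_nodes :: "'a rtree \<Rightarrow> 'a set" where
  "plus_nodes T = nodes T - {root T}"

definition tchain :: "'a rtree \<Rightarrow> 'a set \<Rightarrow> bool" where
  "tchain T S \<longleftrightarrow> pred_on.chain (nodes T) (tle T) S"

definition branch :: "'a rtree \<Rightarrow> 'a set \<Rightarrow> bool" where
  "branch T S \<longleftrightarrow> pred_on.maxchain (nodes T) (tle T) S"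

definition chain_with_least :: "'a rtree \<Rightarrow> 'a set \<Rightarrow> 'a \<Rightarrow> bool" where
  "chain_with_least T S t \<longleftrightarrow> tchain T S \<and> t \<in> S \<and> (\<forall>u \<in> S. tle T t u)"

text \<open>A homomorphism respects both the adjacency and the order of the tree. Order preservation
  is not implied by the other conditions: on the path with root \<open>r\<close>, child \<open>p\<close> and
  grandchild \<open>q\<close>, the map fixing \<open>r\<close> and \<open>p\<close> and sending \<open>q\<close> to \<open>r\<close>
  moves nodes upwards and maps adjacent nodes to adjacent nodes, but it is not monotone.
  For a child \<open>u\<close> of \<open>v\<close>, the conditions together say that \<open>f u\<close> is equal to
  \<open>f v\<close> or is a child of \<open>f v\<close>.\<close>

definition regressive_hom :: "'a rtree \<Rightarrow> ('a \<Rightarrow> 'a) \<Rightarrow> bool" where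
  "regressive_hom T f \<longleftrightarrow>
     f \<in> nodes T \<rightarrow> nodes T \<and>
     (\<forall>t \<in> nodes T. tle T t (f t)) \<and>
     (\<forall>u \<in> nodes T. \<forall>v \<in> nodes T. adjacent T u v \<longrightarrow> f u = f v \<or> adjacent T (f u) (f v)) \<and>
     (\<forall>u \<in> nodes T. \<forall>v \<in> nodes T. tle T u v \<longrightarrow> tle T (f u) (f v))"

definition FIN :: "'a rtree \<Rightarrow> (nat \<rightharpoonup> 'a) set" where
  "FIN T = {b. finite (dom b) \<and> ran b \<subseteq> plus_nodes T \<and> (\<exists>B. branch T B \<and> ran b \<subseteq> B)}"

definition FIN_at :: "'a rtree \<Rightarrow> 'a \<Rightarrow> (nat \<rightharpoonup> 'a) set" where
  "FIN_at T t =
     (if t = root T then {Map.empty} else {b \<in> FIN T. chain_with_least T (ran b) t})"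

definition tau :: "'a rtree \<Rightarrow> ('a \<Rightarrow> 'a) \<Rightarrow> (nat \<rightharpoonup> 'a) \<Rightarrow> (nat \<rightharpoonup> 'a)" where
  "tau T f b = (\<lambda>n. case b n of None \<Rightarrow> None
                   | Some u \<Rightarrow> if f u \<in> plus_nodes T then Some (f u) else None)"

text \<open>\<open>None\<close> means that a sum is undefined. Disjoint domains do not guarantee that the
  union is again in \<open>FIN T\<close>; this is a separate condition on the value of the sum.\<close>

definition fin_add :: "(nat \<rightharpoonup> 'a) \<Rightarrow> (nat \<rightharpoonup> 'a) \<Rightarrow> (nat \<rightharpoonup> 'a) option" where
  "fin_add b0 b1 = (if dom b0 \<inter> dom b1 = {} then Some (b0 ++ b1) else None)"

fun fin_sum_list :: "(nat \<rightharpoonup> 'a) list \<Rightarrow> (nat \<rightharpoonup> 'a) option" where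
  "fin_sum_list [] = Some Map.empty"
| "fin_sum_list (b # bs) = Option.bind (fin_sum_list bs) (fin_add b)"

definition fin_sum :: "(nat \<Rightarrow> (nat \<rightharpoonup> 'a)) \<Rightarrow> nat set \<Rightarrow> (nat \<rightharpoonup> 'a) option" where
  "fin_sum b F = fin_sum_list (map b (sorted_list_of_set F))"

definition set_gt_nat :: "nat set \<Rightarrow> nat \<Rightarrow> bool" where
  "set_gt_nat A d \<longleftrightarrow> (\<forall>a \<in> A. a > d)"

definition set_gt :: "nat set \<Rightarrow> nat set \<Rightarrow> bool" where
  "set_gt B A \<longleftrightarrow> (\<forall>b \<in> B. \<forall>a \<in> A. b > a)"

definition block_seq :: "nat \<Rightarrow> (nat \<Rightarrow> nat set) \<Rightarrow> bool" where
  "block_seq m F \<longleftrightarrow>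
     (\<forall>s<m. finite (F s) \<and> F s \<noteq> {}) \<and> (\<forall>s. Suc s < m \<longrightarrow> Max (F s) < Min (F (Suc s)))"

end

theory Submission
  imports Defs "HOL-Analysis.Function_Topology"
begin

text \<open>Along the branch above a node, a regressive homomorphism only acts on depths, by a map \<open>h\<close>
  with \<open>h 0 = 0\<close> and \<open>h (x + 1) \<in> {h x, h x + 1}\<close>. Relabeling depths by ancestors
  therefore reduces the theorem from trees to functions \<open>\<nat> \<Rightarrow> \<nat>\<close> of finite support under the
  generalized tetris operations \<open>x \<mapsto> h \<circ> x\<close>; the color of a tuple is replaced by the finite
  table of the colors of all its relabelings.

  For such functions one constructs ultrafilters \<open>U l\<close> on the functions of maximum \<open>l\<close> such that
  every \<open>h\<close> maps \<open>U l\<close> to \<open>U (h l)\<close> and \<open>U i + U j = U (max i j)\<close>. Coherent systems form a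
  nonempty compact right-topological semigroup. The absorption laws are reached level by level: from
  an idempotent system \<open>V\<close> whose first \<open>j\<close> levels are already absorbing one passes to
  \<open>V l + \<dots> + V j\<close>, takes an idempotent again, and passes to \<open>V j + \<dots> + V l\<close>. Iterated limits along
  the \<open>U l\<close> then yield the block sequence.\<close>

section \<open>Idempotents in compact right-topological semigroups\<close>

definition subsemigroup_on :: "('a \<Rightarrow> 'a \<Rightarrow> 'a) \<Rightarrow> 'a set \<Rightarrow> bool" where
  "subsemigroup_on g S \<longleftrightarrow> (\<forall>x\<in>S. \<forall>y\<in>S. g x y \<in> S)"

text \<open>Zorn's lemma applies because compactness keeps the intersection of a chain of compact
  subsemigroups nonempty.\<close>

lemma minimal_compact_subsemigroup:
  fixes S :: "'a :: t2_space set"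
  assumes "compact S" "S \<noteq> {}" "subsemigroup_on g S"
  obtains M where "M \<subseteq> S" "compact M" "M \<noteq> {}" "subsemigroup_on g M"
    "\<And>N. N \<subseteq> M \<Longrightarrow> compact N \<Longrightarrow> N \<noteq> {} \<Longrightarrow> subsemigroup_on g N \<Longrightarrow> N = M"
proof -
  define P where "P M \<longleftrightarrow> M \<subseteq> S \<and> compact M \<and> M \<noteq> {} \<and> subsemigroup_on g M" for M
  \<comment> \<open>Complements turn descending chains of subsemigroups into ascending ones, the
    form that \<open>subset_Zorn_nonempty\<close> treats.\<close>
  define \<A> where "\<A> = {- M |M. P M}"
  have "P S" using assms by (auto simp: P_def)
  then have ne: "\<A> \<noteq> {}" by (auto simp: \<A>_def)
  have "\<exists>U\<in>\<A>. \<forall>X\<in>\<A>. U \<subseteq> X \<longrightarrow> X = U"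
  proof (rule subset_Zorn_nonempty[OF ne])
    fix \<C> assume C: "\<C> \<noteq> {}" "subset.chain \<A> \<C>"
    have CP: "P (- X)" if "X \<in> \<C>" for X
      using that C(2) by (auto simp: \<A>_def subset_chain_def)
    have clos: "closed (- X)" if "X \<in> \<C>" for X
      using CP[OF that] by (auto simp: P_def intro: compact_imp_closed)
    let ?M = "S \<inter> (\<Inter>X\<in>\<C>. - X)"
    have "?M \<noteq> {}"
    proof (rule compact_imp_fip_image[OF \<open>compact S\<close>])
      show "closed (- X)" if "X \<in> \<C>" for X using clos that .
    next
      fix I assume I: "finite I" "I \<subseteq> \<C>"
      show "S \<inter> (\<Inter>X\<in>I. - X) \<noteq> {}"
      proof (cases "I = {}")
        case False
        have "subset.chain \<C> I"
          using I C(2) unfolding subset_chain_def by blast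
        then have "\<Union>I \<in> I"
          using Union_in_chain[OF \<open>finite I\<close> False] by (auto simp: subset_chain_def)
        then have "P (- \<Union>I)" using CP I by auto
        then show ?thesis by (auto simp: P_def)
      qed (use assms in auto)
    qed
    moreover have "compact ?M"
      using \<open>compact S\<close> clos by (intro compact_Int_closed) auto
    moreover have "subsemigroup_on g ?M"
      unfolding subsemigroup_on_def
    proof (intro ballI IntI INT_I)
      fix x y assume xy: "x \<in> ?M" "y \<in> ?M"
      then show "g x y \<in> S" using assms(3) by (auto simp: subsemigroup_on_def)
      fix X assume "X \<in> \<C>"
      with CP[OF this] xy show "g x y \<in> - X"
        unfolding P_def subsemigroup_on_def by blast
    qed
    ultimately have "P ?M" by (auto simp: P_def)
    moreover have "\<Union>\<C> = - ?M"
      using CP C(1) by (fastforce simp: P_def)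
    ultimately show "\<Union>\<C> \<in> \<A>" unfolding \<A>_def by blast
  qed
  then obtain U where U: "U \<in> \<A>" "\<forall>X\<in>\<A>. U \<subseteq> X \<longrightarrow> X = U" by blast
  then obtain M where M: "P M" "U = - M" unfolding \<A>_def by blast
  show ?thesis
  proof (rule that[of M])
    fix N assume N: "N \<subseteq> M" "compact N" "N \<noteq> {}" "subsemigroup_on g N"
    then have "P N" using M(1) by (auto simp: P_def)
    then have "- N \<in> \<A>" unfolding \<A>_def by blast
    moreover have "U \<subseteq> - N" using M(2) N(1) by blast
    ultimately have "- N = - M" using U(2) M(2) by blast
    then show "N = M" by blast
  qed (use M(1) in \<open>auto simp: P_def\<close>)
qed

text \<open>In a minimal compact subsemigroup \<open>M\<close>, the set of all \<open>g z x\<close>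
  with \<open>z\<close> in \<open>M\<close> is again a compact subsemigroup and hence all of
  \<open>M\<close>, so some \<open>z\<close> satisfies \<open>g z x = x\<close>. The set of these
  \<open>z\<close> is then also all of \<open>M\<close>; in particular it contains
  \<open>x\<close>.\<close>

theorem Ellis_idempotent:
  fixes S :: "'a :: t2_space set"
  assumes "compact S" "S \<noteq> {}" "subsemigroup_on g S"
    and assoc: "\<And>x y z. g (g x y) z = g x (g y z)"
    and cont: "\<And>y. continuous_on UNIV (\<lambda>x. g x y)"
  obtains x where "x \<in> S" "g x x = x"
proof -
  obtain M where M: "M \<subseteq> S" "compact M" "M \<noteq> {}" "subsemigroup_on g M"
    "\<And>N. N \<subseteq> M \<Longrightarrow> compact N \<Longrightarrow> N \<noteq> {} \<Longrightarrow> subsemigroup_on g N \<Longrightarrow> N = M"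
    using minimal_compact_subsemigroup[OF assms(1-3)] by metis
  obtain x where x: "x \<in> M" using M(3) by blast
  have "(\<lambda>z. g z x) ` M = M"
  proof (rule M(5))
    show "(\<lambda>z. g z x) ` M \<subseteq> M" using M(4) x by (auto simp: subsemigroup_on_def)
    show "compact ((\<lambda>z. g z x) ` M)"
      by (rule compact_continuous_image[OF continuous_on_subset[OF cont] M(2)]) simp
    show "(\<lambda>z. g z x) ` M \<noteq> {}" using x by blast
    show "subsemigroup_on g ((\<lambda>z. g z x) ` M)"
      using M(4) x unfolding subsemigroup_on_def by (simp flip: assoc)
  qed
  then obtain z where z: "z \<in> M" "g z x = x" using x by (metis imageE)
  have "M \<inter> (\<lambda>z. g z x) -` {x} = M"
  proof (rule M(5))
    show "compact (M \<inter> (\<lambda>z. g z x) -` {x})"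
      by (rule compact_Int_closed[OF M(2)]) (intro closed_vimage cont closed_singleton)
    show "subsemigroup_on g (M \<inter> (\<lambda>z. g z x) -` {x})"
      using M(4) unfolding subsemigroup_on_def by (simp add: assoc)
  qed (use z in auto)
  then have "g x x = x" using x by blast
  with x M(1) that show ?thesis by blast
qed

section \<open>Ultrafilters as points of a product space\<close>

text \<open>A family of sets is identified with its indicator \<open>p\<close>, so that \<open>p A\<close> reads
  ``for \<open>p\<close>-many \<open>x\<close>, \<open>x \<in> A\<close>''. The operations below are then total, and their
  algebraic laws hold without any assumption on \<open>p\<close>.\<close>

type_synonym 'x quant = "'x set \<Rightarrow> bool"

text \<open>An ultrafilter, written as a Boolean homomorphism into \<open>bool\<close>. Upward
  closure and properness follow, and each equation mentions at most three sets, which makes the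
  condition closed.\<close>

definition ultra :: "'x quant \<Rightarrow> bool" where
  "ultra p \<longleftrightarrow> (\<forall>A B. p (A \<inter> B) = (p A \<and> p B)) \<and> (\<forall>A. p (- A) = (\<not> p A))"

definition qmap :: "('x \<Rightarrow> 'y) \<Rightarrow> 'x quant \<Rightarrow> 'y quant" where
  "qmap h p A \<longleftrightarrow> p (h -` A)"

text \<open>The usual extension of a semigroup operation to ultrafilters. Pointwise maximum replaces
  the partial addition: it is total, agrees with the sum on disjoint supports, and commutes with
  tetris maps because these are monotone.\<close>

definition qsup :: "'x::semilattice_sup quant \<Rightarrow> 'x quant \<Rightarrow> 'x quant" where
  "qsup p q A \<longleftrightarrow> p {x. q {y. sup x y \<in> A}}"

lemma qsup_assoc: "qsup (qsup p q) r = qsup p (qsup q r)"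
  by (simp add: qsup_def fun_eq_iff sup.assoc)

lemma qmap_qsup:
  assumes "\<And>x y. h (sup x y) = sup (h x) (h y)"
  shows "qmap h (qsup p q) = qsup (qmap h p) (qmap h q)"
  by (simp add: qsup_def qmap_def fun_eq_iff assms vimage_def)

lemma ultra_Int: "ultra p \<Longrightarrow> p (A \<inter> B) \<longleftrightarrow> p A \<and> p B"
  by (simp add: ultra_def)

lemma ultra_Compl: "ultra p \<Longrightarrow> p (- A) \<longleftrightarrow> \<not> p A"
  by (simp add: ultra_def)

lemma ultra_mono: "ultra p \<Longrightarrow> p A \<Longrightarrow> A \<subseteq> B \<Longrightarrow> p B"
  by (metis inf.absorb1 ultra_Int)

lemma ultra_UNIV: "ultra p \<Longrightarrow> p UNIV"
  by (metis Compl_UNIV_eq subset_UNIV ultra_Compl ultra_mono)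

lemma ultra_empty: "ultra p \<Longrightarrow> \<not> p {}"
  by (metis Compl_UNIV_eq ultra_Compl ultra_UNIV)

lemma ultra_Ball:
  assumes "ultra p" "finite I"
  shows "p {x. \<forall>i\<in>I. P i x} \<longleftrightarrow> (\<forall>i\<in>I. p {x. P i x})"
  using assms(2)
proof (induction rule: finite_induct)
  case (insert i I)
  have "{x. \<forall>j\<in>insert i I. P j x} = {x. P i x} \<inter> {x. \<forall>j\<in>I. P j x}" by auto
  with insert show ?case by (simp add: ultra_Int[OF assms(1)])
qed (simp add: ultra_UNIV[OF assms(1)])

lemma ultra_conj: "ultra p \<Longrightarrow> p {x. P x \<and> Q x} \<longleftrightarrow> p {x. P x} \<and> p {x. Q x}"
  by (simp add: Collect_conj_eq ultra_Int)

lemma ultra_finite_range: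
  assumes "ultra p" "finite C" "\<And>x. f x \<in> C"
  obtains a where "p {x. f x = a}"
proof -
  have empty: "{x. \<forall>a\<in>C. f x \<noteq> a} = {}" using assms(3) by auto
  have "\<not> p {x. \<forall>a\<in>C. f x \<noteq> a}"
    unfolding empty by (rule ultra_empty[OF assms(1)])
  then have "\<exists>a\<in>C. \<not> p {x. f x \<noteq> a}"
    unfolding ultra_Ball[OF assms(1,2)] by blast
  then obtain a where "\<not> p (- {x. f x = a})" by (auto simp: Collect_neg_eq)
  with that show ?thesis using ultra_Compl[OF assms(1)] by blast
qed

lemma ultra_qsup: "ultra p \<Longrightarrow> ultra q \<Longrightarrow> ultra (qsup p q)"
  unfolding ultra_def qsup_def by (simp add: Collect_conj_eq Collect_neg_eq)

lemma ultra_principal: "ultra (\<lambda>A. x \<in> A)"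
  by (simp add: ultra_def)

lemma qsup_mem:
  assumes "ultra p" "ultra q" "p A" "q B" "\<And>x y. x \<in> A \<Longrightarrow> y \<in> B \<Longrightarrow> sup x y \<in> D"
  shows "qsup p q D"
  unfolding qsup_def
proof (rule ultra_mono[OF assms(1,3)])
  show "A \<subseteq> {x. q {y. sup x y \<in> D}}"
    using assms(5) by (auto intro: ultra_mono[OF assms(2,4)])
qed

section \<open>The compact product topology on quantifiers\<close>

instance "fun" :: (type, t2_space) t2_space
proof
  fix f g :: "'a \<Rightarrow> 'b" assume "f \<noteq> g"
  then obtain x where "f x \<noteq> g x" by auto
  then obtain U V where UV: "open U" "open V" "f x \<in> U" "g x \<in> V" "U \<inter> V = {}"
    using hausdorff by metis
  have "open ((\<lambda>h :: 'a \<Rightarrow> 'b. h x) -` W)" if "open W" for W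
    by (intro open_vimage that continuous_on_product_coordinates)
  with UV show "\<exists>U V. open U \<and> open V \<and> f \<in> U \<and> g \<in> V \<and> U \<inter> V = {}"
    by (intro exI[of _ "(\<lambda>h. h x) -` U"] exI[of _ "(\<lambda>h. h x) -` V"]) auto
qed

lemma compact_UNIV_fun:
  assumes "compact (UNIV :: 'b::topological_space set)"
  shows "compact (UNIV :: ('a \<Rightarrow> 'b) set)"
proof -
  have "compact_space (product_topology (\<lambda>_::'a. euclidean :: 'b topology) UNIV)"
    unfolding compact_space_product_topology using assms by (simp add: compact_space_def)
  then have "compact_space (euclidean :: ('a \<Rightarrow> 'b) topology)"
    by (simp only: euclidean_product_topology)
  then show ?thesis by (simp only: compact_space_def topspace_euclidean compactin_euclidean_iff)
qed

lemma compact_UNIV_quant_seq: "compact (UNIV :: (nat \<Rightarrow> 'x quant) set)"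
  by (intro compact_UNIV_fun finite_imp_compact) simp

lemma continuous_qmap: "continuous_on UNIV (qmap h)"
  unfolding qmap_def[abs_def]
  by (intro continuous_on_coordinatewise_then_product continuous_on_product_coordinates)

text \<open>For fixed \<open>q\<close> and \<open>A\<close>, the value \<open>qsup p q A\<close> is
  \<open>p\<close> evaluated at one fixed set, so it is a coordinate of \<open>p\<close>.\<close>

lemma continuous_qsup_left: "continuous_on UNIV (\<lambda>p. qsup p q)"
  unfolding qsup_def[abs_def]
  by (intro continuous_on_coordinatewise_then_product continuous_on_product_coordinates)

lemma closed_mem_quant: "closed {p :: 'x quant. p A}"
proof -
  have "closed ((\<lambda>p :: 'x quant. p A) -` {True})"
    by (intro closed_vimage closed_singleton continuous_on_product_coordinates)
  then show ?thesis by (simp add: vimage_def)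
qed

lemma closed_ultra: "closed {p :: 'x quant. ultra p}"
proof -
  have clo: "closed {p :: 'x quant. Q (p A) (p B) (p D)}" for A B D and Q :: "bool \<Rightarrow> bool \<Rightarrow> bool \<Rightarrow> bool"
  proof -
    have c: "continuous_on UNIV (\<lambda>p :: 'x quant. p A)" for A
      by (rule continuous_on_product_coordinates)
    have "closed ((\<lambda>p :: 'x quant. (p A, p B, p D)) -` {(a, b, d). Q a b d})"
      by (intro closed_vimage continuous_on_Pair c finite_imp_closed) simp
    then show ?thesis by (simp add: vimage_def)
  qed
  have "{p :: 'x quant. ultra p} =
      (\<Inter>A. \<Inter>B. {p. p (A \<inter> B) = (p A \<and> p B)}) \<inter> (\<Inter>A. {p. p (- A) = (\<not> p A)})"
    by (auto simp: ultra_def)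
  also have "closed \<dots>"
    using clo[where Q = "\<lambda>a b d. a = (b \<and> d)"] clo[where Q = "\<lambda>a b d. a = (\<not> b)"]
    by (intro closed_Int closed_INT) auto
  finally show ?thesis .
qed

section \<open>Coherent systems of ultrafilters\<close>

definition tetris :: "(nat \<Rightarrow> nat) \<Rightarrow> bool" where
  "tetris h \<longleftrightarrow> h 0 = 0 \<and> (\<forall>x. h (Suc x) = h x \<or> h (Suc x) = Suc (h x))"

lemma tetris_mono:
  assumes "tetris h"
  shows "mono h"
  unfolding mono_iff_le_Suc
proof
  fix x
  have "h (Suc x) = h x \<or> h (Suc x) = Suc (h x)" using assms by (simp add: tetris_def)
  then show "h x \<le> h (Suc x)" by auto
qed

lemma tetris_le:
  assumes "tetris h"
  shows "h x \<le> x"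
proof (induction x)
  case (Suc x)
  have "h (Suc x) = h x \<or> h (Suc x) = Suc (h x)" using assms by (simp add: tetris_def)
  with Suc show ?case by auto
qed (use assms in \<open>simp add: tetris_def\<close>)

lemma tetris_comp: "tetris g \<Longrightarrow> tetris h \<Longrightarrow> tetris (g \<circ> h)"
  unfolding tetris_def comp_def by (metis)

lemma tetris_sup: "tetris h \<Longrightarrow> h \<circ> sup x y = sup (h \<circ> x) (h \<circ> y)"
  by (simp add: fun_eq_iff sup_max max_of_mono[OF tetris_mono])

definition peak :: "nat \<Rightarrow> (nat \<Rightarrow> nat) set" where
  "peak l = {x. finite {n. x n \<noteq> 0} \<and> (\<forall>n. x n \<le> l) \<and> (\<exists>n. x n = l)}"

lemma peak_0: "peak 0 = {\<lambda>_. 0}"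
  by (auto simp: peak_def)

lemma peak_sup_le:
  assumes "x \<in> peak l" "y \<in> peak k" "k \<le> l"
  shows "sup x y \<in> peak l" "sup y x \<in> peak l"
proof -
  have "{n. sup x y n \<noteq> 0} \<subseteq> {n. x n \<noteq> 0} \<union> {n. y n \<noteq> 0}" by (auto simp: sup_max)
  then have fin: "finite {n. sup x y n \<noteq> 0}"
    using assms by (auto simp: peak_def dest: finite_subset)
  have y: "y n \<le> l" for n using assms by (auto simp: peak_def intro: le_trans)
  obtain n where "x n = l" using assms by (auto simp: peak_def)
  then have "sup x y n = l" using y[of n] by (simp add: sup_max)
  moreover have "sup x y n \<le> l" for n using assms y[of n] by (simp add: peak_def sup_max)
  ultimately show "sup x y \<in> peak l" using fin unfolding peak_def by blast
  then show "sup y x \<in> peak l" by (simp add: sup.commute)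
qed

lemma peak_comp:
  assumes "tetris h" "x \<in> peak l"
  shows "h \<circ> x \<in> peak (h l)"
proof -
  have "{n. h (x n) \<noteq> 0} \<subseteq> {n. x n \<noteq> 0}" using assms(1) by (auto simp: tetris_def intro: gr0I)
  then show ?thesis
    using assms monoD[OF tetris_mono[OF assms(1)]]
    by (auto simp: peak_def dest: finite_subset)
qed

text \<open>The condition for all \<open>d\<close> pushes the supports beyond every bound, so that a
  block can be chosen after any given position. The last condition ties the levels together: every
  level below \<open>l\<close> is an image of level \<open>l\<close>.\<close>

definition coherent :: "(nat \<Rightarrow> (nat \<Rightarrow> nat) quant) \<Rightarrow> bool" where
  "coherent V \<longleftrightarrow>
     (\<forall>l. ultra (V l) \<and> V l (peak l) \<and> (\<forall>d. V l {x. \<forall>n\<le>d. x n = 0})) \<and>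
     (\<forall>h l. tetris h \<longrightarrow> qmap ((\<circ>) h) (V l) = V (h l))"

lemma coherentD:
  assumes "coherent V"
  shows "ultra (V l)" "V l (peak l)" "V l {x. \<forall>n\<le>d. x n = 0}"
  using assms by (auto simp: coherent_def)

lemma coherent_qmap: "coherent V \<Longrightarrow> tetris h \<Longrightarrow> qmap ((\<circ>) h) (V l) = V (h l)"
  by (simp add: coherent_def)

text \<open>\<open>peak 0\<close> is a singleton, so level 0 is principal. Hence it is neutral for
  \<open>qsup\<close>, which starts the induction on absorption and later accounts for empty
  blocks.\<close>

lemma coherent_0:
  assumes "coherent V"
  shows "V 0 = (\<lambda>A. (\<lambda>_. 0) \<in> A)"
proof
  fix A
  have u: "ultra (V 0)" and p: "V 0 {\<lambda>_. 0}"
    using coherentD(1,2)[OF assms, of 0] by (auto simp: peak_0)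
  have "V 0 A \<longleftrightarrow> V 0 (A \<inter> {\<lambda>_. 0})" using u p by (simp add: ultra_Int)
  also have "\<dots> \<longleftrightarrow> (\<lambda>_. 0) \<in> A"
    using u p by (cases "(\<lambda>_. 0) \<in> A") (auto simp: ultra_empty)
  finally show "V 0 A = ((\<lambda>_. 0) \<in> A)" .
qed

lemma sup_zero_fun [simp]: "sup (\<lambda>_. 0 :: nat) x = x" "sup x (\<lambda>_. 0 :: nat) = x"
  by (auto simp: fun_eq_iff sup_max)

lemma coherent_qsup_0:
  assumes "coherent V"
  shows "qsup (V 0) q = q" "qsup q (V 0) = q"
  by (simp_all add: coherent_0[OF assms] qsup_def fun_eq_iff)

lemma qsup_concentrated:
  assumes "ultra p" "ultra q" "p {x. \<forall>n\<le>d. x n = (0 :: nat)}" "q {x. \<forall>n\<le>d. x n = 0}"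
  shows "qsup p q {x. \<forall>n\<le>d. x n = 0}"
  by (rule qsup_mem[OF assms]) auto

lemma qmap_qsup_tetris:
  "tetris h \<Longrightarrow> qmap ((\<circ>) h) (qsup p q) = qsup (qmap ((\<circ>) h) p) (qmap ((\<circ>) h) q)"
  by (rule qmap_qsup) (rule tetris_sup)

definition seq_qsup :: "(nat \<Rightarrow> (nat \<Rightarrow> nat) quant) \<Rightarrow> (nat \<Rightarrow> (nat \<Rightarrow> nat) quant) \<Rightarrow> nat \<Rightarrow> (nat \<Rightarrow> nat) quant" where
  "seq_qsup V W l = qsup (V l) (W l)"

lemma seq_qsup_assoc: "seq_qsup (seq_qsup U V) W = seq_qsup U (seq_qsup V W)"
  by (simp add: seq_qsup_def fun_eq_iff qsup_assoc)

lemma continuous_coordinate_qsup: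
  "continuous_on UNIV (\<lambda>V :: nat \<Rightarrow> 'x::semilattice_sup quant. qsup (V l) q)"
  by (rule continuous_on_compose2[OF continuous_qsup_left continuous_on_product_coordinates]) simp

lemma continuous_seq_qsup: "continuous_on UNIV (\<lambda>V. seq_qsup V W)"
  unfolding seq_qsup_def[abs_def]
  by (intro continuous_on_coordinatewise_then_product continuous_coordinate_qsup)

lemma coherent_seq_qsup:
  assumes "coherent V" "coherent W"
  shows "coherent (seq_qsup V W)"
  unfolding coherent_def seq_qsup_def
proof safe
  fix l
  note V = coherentD[OF assms(1)] and W = coherentD[OF assms(2)]
  show "ultra (qsup (V l) (W l))"
    using V(1) W(1) by (rule ultra_qsup)
  show "qsup (V l) (W l) (peak l)"
    by (rule qsup_mem[OF V(1) W(1) V(2) W(2)]) (use peak_sup_le in auto)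
  show "qsup (V l) (W l) {x. \<forall>n\<le>d. x n = 0}" for d
    using V(1) W(1) V(3) W(3) by (rule qsup_concentrated)
  show "qmap ((\<circ>) h) (qsup (V l) (W l)) = qsup (V (h l)) (W (h l))" if "tetris h" for h
    using that by (simp only: qmap_qsup_tetris coherent_qmap[OF assms(1)] coherent_qmap[OF assms(2)])
qed

lemma closed_coordinate:
  assumes "closed S"
  shows "closed {V :: nat \<Rightarrow> 'x quant. V l \<in> S}"
proof -
  have "closed ((\<lambda>V :: nat \<Rightarrow> 'x quant. V l) -` S)"
    by (intro closed_vimage assms continuous_on_product_coordinates)
  then show ?thesis by (simp add: vimage_def)
qed

text \<open>The set \<open>D\<close> of thresholds is a parameter: singletons occur in the
  compactness argument for existence, and \<open>UNIV\<close> gives coherence itself.\<close>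

lemma closed_coherent_upto:
  "closed {V. (\<forall>l. ultra (V l) \<and> V l (peak l) \<and> (\<forall>d\<in>D. V l {x. \<forall>n\<le>d. x n = 0})) \<and>
     (\<forall>h l. tetris h \<longrightarrow> qmap ((\<circ>) h) (V l) = V (h l))}" (is "closed ?Z")
proof -
  have "?Z = (\<Inter>l. {V. V l \<in> {p. ultra p}} \<inter> {V. V l \<in> {p. p (peak l)}} \<inter>
        (\<Inter>d\<in>D. {V. V l \<in> {p. p {x. \<forall>n\<le>d. x n = 0}}})) \<inter>
      (\<Inter>h\<in>Collect tetris. \<Inter>l. {V. qmap ((\<circ>) h) (V l) = V (h l)})"
    by auto
  also have "closed \<dots>"
    by (intro closed_Int closed_INT ballI closed_coordinate closed_ultra closed_mem_quant
        closed_Collect_eq continuous_on_product_coordinates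
        continuous_on_compose2[OF continuous_qmap continuous_on_product_coordinates] subset_UNIV)
  finally show ?thesis .
qed

lemma closed_coherent: "closed {V. coherent V}"
  using closed_coherent_upto[of UNIV] by (simp add: coherent_def)

text \<open>A single column of height \<open>l\<close> is mapped by \<open>h\<close> to a single column of height \<open>h l\<close>, so
  limits of single columns are coherent.\<close>

lemma ex_coherent: "\<exists>V. coherent V"
proof -
  define Z where "Z D = {V. (\<forall>l. ultra (V l) \<and> V l (peak l) \<and> (\<forall>d\<in>D. V l {x. \<forall>n\<le>d. x n = 0})) \<and>
     (\<forall>h l. tetris h \<longrightarrow> qmap ((\<circ>) h) (V l) = V (h l))}" for D
  have ne: "Z D \<noteq> {}" if "finite D" for D
  proof -
    define N where "N = Suc (Max (insert 0 D))"
    define V where "V l = (\<lambda>A. (\<lambda>n. if n = N then l else 0) \<in> A)" for l :: nat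
    have N: "d < N" if "d \<in> D" for d
      using that \<open>finite D\<close> by (simp add: N_def less_Suc_eq_le)
    have comp: "h \<circ> (\<lambda>n. if n = N then l else 0) = (\<lambda>n. if n = N then h l else 0)"
      if "tetris h" for h l
      using that by (auto simp: tetris_def fun_eq_iff)
    have "qmap ((\<circ>) h) (V l) = V (h l)" if "tetris h" for h l
      by (rule ext) (simp add: qmap_def V_def comp[OF that])
    moreover have "V l {x. \<forall>n\<le>d. x n = 0}" if "d \<in> D" for l d
      using N[OF that] by (auto simp: V_def)
    ultimately have "V \<in> Z D"
      by (auto simp: Z_def) (auto simp: V_def ultra_principal peak_def)
    then show ?thesis by blast
  qed
  have "UNIV \<inter> (\<Inter>d. Z {d}) \<noteq> {}"
  proof (rule compact_imp_fip_image[OF compact_UNIV_quant_seq])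
    show "closed (Z {d})" for d unfolding Z_def by (rule closed_coherent_upto)
  next
    fix I :: "nat set" assume "finite I"
    then have "Z I \<noteq> {}" by (rule ne)
    moreover have "Z I \<subseteq> (\<Inter>d\<in>I. Z {d})" by (auto simp: Z_def)
    ultimately show "UNIV \<inter> (\<Inter>d\<in>I. Z {d}) \<noteq> {}" by blast
  qed
  then obtain V where "\<forall>d. V \<in> Z {d}" by blast
  then have "coherent V" by (auto simp: Z_def coherent_def)
  then show ?thesis by blast
qed

section \<open>Absorption laws\<close>

text \<open>Equivalently, levels \<open>i\<close> and \<open>j\<close> up to \<open>J\<close> add up
  to level \<open>max i j\<close>. The case \<open>i = j\<close> makes each of these levels
  idempotent.\<close>

definition absorbing :: "nat \<Rightarrow> (nat \<Rightarrow> (nat \<Rightarrow> nat) quant) \<Rightarrow> bool" where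
  "absorbing J V \<longleftrightarrow> (\<forall>i j. i \<le> j \<longrightarrow> j \<le> J \<longrightarrow> qsup (V i) (V j) = V j \<and> qsup (V j) (V i) = V j)"

text \<open>For \<open>l \<ge> j\<close> this is \<open>V l + ... + V (j + 1) + V j\<close>, with
  \<open>+\<close> for \<open>qsup\<close>. The levels up to \<open>j\<close> stay as they are, so
  that absorption already achieved survives. \<open>asc_sum\<close> is the same sum in reverse
  order.\<close>

fun desc_sum :: "(nat \<Rightarrow> (nat \<Rightarrow> nat) quant) \<Rightarrow> nat \<Rightarrow> nat \<Rightarrow> (nat \<Rightarrow> nat) quant" where
  "desc_sum V j 0 = V 0"
| "desc_sum V j (Suc l) = (if Suc l \<le> j then V (Suc l) else qsup (V (Suc l)) (desc_sum V j l))"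

fun asc_sum :: "(nat \<Rightarrow> (nat \<Rightarrow> nat) quant) \<Rightarrow> nat \<Rightarrow> nat \<Rightarrow> (nat \<Rightarrow> nat) quant" where
  "asc_sum V j 0 = V 0"
| "asc_sum V j (Suc l) = (if Suc l \<le> j then V (Suc l) else qsup (asc_sum V j l) (V (Suc l)))"

lemma desc_sum_le: "l \<le> j \<Longrightarrow> desc_sum V j l = V l"
  by (cases l) auto

lemma asc_sum_le: "l \<le> j \<Longrightarrow> asc_sum V j l = V l"
  by (cases l) auto

lemma desc_sum_absorbed:
  assumes "absorbing j V" "j \<le> l"
  shows "qsup (desc_sum V j l) (V j) = desc_sum V j l"
  using assms(2)
proof (induction l rule: dec_induct)
  case base
  then show ?case using assms(1) by (simp add: desc_sum_le absorbing_def)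
next
  case (step l)
  then show ?case by (simp add: qsup_assoc)
qed

text \<open>A tetris map repeats or drops summands of the decreasing sum. Repetitions are harmless
  because \<open>V\<close> is idempotent, and what remains below \<open>j\<close> is absorbed.\<close>

lemma coherent_desc_sum:
  assumes V: "coherent V" "seq_qsup V V = V" and abs: "absorbing j V"
  shows "coherent (desc_sum V j)"
proof -
  have idem: "qsup (V l) (V l) = V l" for l
    using fun_cong[OF V(2), of l] by (simp add: seq_qsup_def)
  have step: "qsup (V l) (desc_sum V j l) = desc_sum V j l" for l
    by (cases l) (auto simp: idem simp flip: qsup_assoc)
  have "ultra (desc_sum V j l) \<and> desc_sum V j l (peak l) \<and> desc_sum V j l {x. \<forall>n\<le>d. x n = 0}" for l d
  proof (induction l)
    case 0
    then show ?case using coherentD[OF V(1)] by simp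
  next
    case (Suc l)
    note c = coherentD[OF V(1), of "Suc l"]
    have "qsup (V (Suc l)) (desc_sum V j l) (peak (Suc l))"
      by (rule qsup_mem[OF c(1) _ c(2)]) (use Suc peak_sup_le in auto)
    then show ?case using Suc c by (auto intro: ultra_qsup qsup_concentrated)
  qed
  moreover have "qmap ((\<circ>) h) (desc_sum V j l) = desc_sum V j (h l)" if h: "tetris h" for h l
  proof (induction l)
    case 0
    have "h 0 = 0" using h by (simp add: tetris_def)
    then show ?case using coherent_qmap[OF V(1) h, of 0] by (simp only: desc_sum.simps)
  next
    case (Suc l)
    show ?case
    proof (cases "Suc l \<le> j")
      case True
      then have "h (Suc l) \<le> j" using tetris_le[OF h, of "Suc l"] by simp
      then show ?thesis using True coherent_qmap[OF V(1) h, of "Suc l"] by (simp only: desc_sum_le)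
    next
      case False
      then have eq: "qmap ((\<circ>) h) (desc_sum V j (Suc l)) = qsup (V (h (Suc l))) (desc_sum V j (h l))"
        by (simp only: desc_sum.simps if_False qmap_qsup_tetris[OF h] Suc coherent_qmap[OF V(1) h])
      consider "h (Suc l) = h l" | "h (Suc l) = Suc (h l)" using h by (auto simp: tetris_def)
      then show ?thesis
      proof cases
        case 2
        then show ?thesis unfolding eq using abs by (auto simp: desc_sum_le absorbing_def)
      qed (simp only: eq step)
    qed
  qed
  ultimately show ?thesis by (simp add: coherent_def)
qed

text \<open>The mirror image of \<open>coherent_desc_sum\<close>: repeated terms now meet at the
  right end of the sum.\<close>

lemma coherent_asc_sum:
  assumes V: "coherent V" "seq_qsup V V = V" and abs: "absorbing j V"
  shows "coherent (asc_sum V j)"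
proof -
  have idem: "qsup (V l) (V l) = V l" for l
    using fun_cong[OF V(2), of l] by (simp add: seq_qsup_def)
  have step: "qsup (asc_sum V j l) (V l) = asc_sum V j l" for l
    by (cases l) (auto simp: idem qsup_assoc)
  have "ultra (asc_sum V j l) \<and> asc_sum V j l (peak l) \<and> asc_sum V j l {x. \<forall>n\<le>d. x n = 0}" for l d
  proof (induction l)
    case 0
    then show ?case using coherentD[OF V(1)] by simp
  next
    case (Suc l)
    note c = coherentD[OF V(1), of "Suc l"]
    have "qsup (asc_sum V j l) (V (Suc l)) (peak (Suc l))"
      by (rule qsup_mem[OF _ c(1) _ c(2)]) (use Suc peak_sup_le in auto)
    then show ?case using Suc c by (auto intro: ultra_qsup qsup_concentrated)
  qed
  moreover have "qmap ((\<circ>) h) (asc_sum V j l) = asc_sum V j (h l)" if h: "tetris h" for h l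
  proof (induction l)
    case 0
    have "h 0 = 0" using h by (simp add: tetris_def)
    then show ?case using coherent_qmap[OF V(1) h, of 0] by (simp only: asc_sum.simps)
  next
    case (Suc l)
    show ?case
    proof (cases "Suc l \<le> j")
      case True
      then have "h (Suc l) \<le> j" using tetris_le[OF h, of "Suc l"] by simp
      then show ?thesis using True coherent_qmap[OF V(1) h, of "Suc l"] by (simp only: asc_sum_le)
    next
      case False
      then have eq: "qmap ((\<circ>) h) (asc_sum V j (Suc l)) = qsup (asc_sum V j (h l)) (V (h (Suc l)))"
        by (simp only: asc_sum.simps if_False qmap_qsup_tetris[OF h] Suc coherent_qmap[OF V(1) h])
      consider "h (Suc l) = h l" | "h (Suc l) = Suc (h l)" using h by (auto simp: tetris_def)
      then show ?thesis
      proof cases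
        case 2
        then show ?thesis unfolding eq using abs by (auto simp: asc_sum_le absorbing_def)
      qed (simp only: eq step)
    qed
  qed
  ultimately show ?thesis by (simp add: coherent_def)
qed

lemma absorbing_cong: "absorbing J V \<Longrightarrow> (\<And>i. i \<le> J \<Longrightarrow> W i = V i) \<Longrightarrow> absorbing J W"
  by (auto simp: absorbing_def)

text \<open>Ellis' theorem is used twice: \<open>desc_sum\<close> makes the upper levels absorb \<open>U j\<close> on the right, and
  among the systems with this closed property there is again an idempotent one, to which
  \<open>asc_sum\<close> is applied.\<close>

lemma absorbing_step:
  assumes U: "coherent U" "absorbing j U"
  shows "\<exists>W. coherent W \<and> absorbing (Suc j) W"
proof -
  \<comment> \<open>Fixing the levels up to \<open>j\<close> preserves their absorption laws; since
    these levels are idempotent, \<open>Z\<close> is closed under \<open>seq_qsup\<close>.\<close>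
  define Z where "Z = {V. coherent V} \<inter> (\<Inter>i\<in>{..j}. {V. V i = U i})"
  have closZ: "closed Z"
    unfolding Z_def using closed_coordinate[OF closed_singleton]
    by (intro closed_Int closed_coherent closed_INT) auto
  have absZ: "absorbing j V" if "V \<in> Z" for V
    by (rule absorbing_cong[OF U(2)]) (use that in \<open>auto simp: Z_def\<close>)
  have sgZ: "subsemigroup_on seq_qsup Z"
    using coherent_seq_qsup U(2)
    by (auto simp: subsemigroup_on_def Z_def absorbing_def, simp add: seq_qsup_def)
  have compact: "compact S" if "closed S" for S :: "(nat \<Rightarrow> (nat \<Rightarrow> nat) quant) set"
    using compact_Int_closed[OF compact_UNIV_quant_seq that] by simp
  have "U \<in> Z" using U by (auto simp: Z_def)
  then obtain V1 where V1: "V1 \<in> Z" "seq_qsup V1 V1 = V1"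
    using Ellis_idempotent[OF compact[OF closZ] _ sgZ seq_qsup_assoc continuous_seq_qsup] by blast
  \<comment> \<open>Absorbing the fixed ultrafilter \<open>U j\<close> on the right is a closed
    condition, because \<open>qsup\<close> is continuous in its left argument, and it passes to
    products by associativity.\<close>
  define Y where "Y = Z \<inter> (\<Inter>l\<in>{j..}. {V. qsup (V l) (U j) = V l})"
  have "closed Y"
    unfolding Y_def
    by (intro closed_Int closZ closed_INT ballI closed_Collect_eq continuous_coordinate_qsup
        continuous_on_product_coordinates)
  moreover have "desc_sum V1 j \<in> Y"
  proof -
    have "V1 i = U i" if "i \<le> j" for i using V1 that by (auto simp: Z_def)
    moreover have "coherent (desc_sum V1 j)"
      using V1 absZ by (intro coherent_desc_sum) (auto simp: Z_def)
    ultimately show ?thesis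
      using desc_sum_absorbed[OF absZ[OF V1(1)]] by (auto simp: Y_def Z_def desc_sum_le)
  qed
  moreover have "subsemigroup_on seq_qsup Y"
    using sgZ by (auto simp: subsemigroup_on_def Y_def) (simp add: seq_qsup_def qsup_assoc)
  ultimately obtain V where V: "V \<in> Y" "seq_qsup V V = V"
    using Ellis_idempotent[OF compact _ _ seq_qsup_assoc continuous_seq_qsup] by blast
  then have VZ: "V \<in> Z" by (simp add: Y_def)
  define W where "W = asc_sum V j"
  have "coherent W"
    unfolding W_def using VZ V absZ by (intro coherent_asc_sum) (auto simp: Z_def)
  have Wle: "W i = V i" if "i \<le> j" for i using that by (simp add: W_def asc_sum_le)
  have WSuc: "W (Suc j) = qsup (V j) (V (Suc j))"
    by (simp add: W_def asc_sum_le)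
  have absV: "qsup (V i) (V j) = V j" "qsup (V j) (V i) = V j" if "i \<le> j" for i
    using absZ[OF VZ] that by (auto simp: absorbing_def)
  have right: "qsup (V (Suc j)) (V j) = V (Suc j)"
    using V(1) by (auto simp: Y_def Z_def)
  have idem: "qsup (V (Suc j)) (V (Suc j)) = V (Suc j)"
    using fun_cong[OF V(2), of "Suc j"] by (simp add: seq_qsup_def)
  have "qsup (W i) (W (Suc j)) = W (Suc j)" if "i \<le> j" for i
    using that absV by (simp add: WSuc Wle flip: qsup_assoc)
  \<comment> \<open>Insert \<open>V j\<close> after \<open>V (Suc j)\<close> by
    \<open>right\<close>, let it swallow \<open>V i\<close>, and remove it again.\<close>
  moreover have "qsup (W (Suc j)) (W i) = W (Suc j)" if "i \<le> j" for i
    by (metis WSuc Wle absV(2) qsup_assoc right that)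
  moreover have "qsup (W (Suc j)) (W (Suc j)) = W (Suc j)"
    by (metis WSuc idem qsup_assoc right)
  moreover have "absorbing j W" using absorbing_cong[OF absZ[OF VZ] Wle] .
  ultimately have "absorbing (Suc j) W" by (auto simp: absorbing_def le_Suc_eq)
  with \<open>coherent W\<close> show ?thesis by blast
qed

theorem ex_coherent_absorbing: "\<exists>V. coherent V \<and> absorbing J V"
proof (induction J)
  case 0
  obtain V where "coherent V" using ex_coherent by blast
  then show ?case by (auto simp: absorbing_def coherent_qsup_0)
qed (use absorbing_step in blast)

section \<open>From coherent systems to block sequences\<close>

text \<open>An iterated ultrafilter quantifier: the coordinates \<open>l\<close>, ...,
  \<open>l + n - 1\<close> of \<open>x\<close> are overwritten from left to right by generic values,
  while all others are kept.\<close>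

fun iter :: "(nat \<Rightarrow> 'x quant) \<Rightarrow> ((nat \<Rightarrow> 'x) \<Rightarrow> bool) \<Rightarrow> nat \<Rightarrow> nat \<Rightarrow> (nat \<Rightarrow> 'x) \<Rightarrow> bool" where
  "iter Q P l 0 x = P x"
| "iter Q P l (Suc n) x = Q l {w. iter Q P (Suc l) n (x(l := w))}"

text \<open>By induction every \<open>w\<close> has a color for the remaining quantifiers. There are
  finitely many colors, so one of them occurs for a large set of \<open>w\<close>.\<close>

lemma iter_finite_range:
  assumes "\<And>s. ultra (Q s)" "finite (range c)"
  shows "\<exists>a \<in> range c. iter Q (\<lambda>x. c x = a) l n x"
proof (induction n arbitrary: l x)
  case (Suc n)
  have "\<forall>w. \<exists>a. a \<in> range c \<and> iter Q (\<lambda>x. c x = a) (Suc l) n (x(l := w))"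
  proof
    fix w
    show "\<exists>a. a \<in> range c \<and> iter Q (\<lambda>x. c x = a) (Suc l) n (x(l := w))"
      using Suc[of "Suc l" "x(l := w)"] unfolding Bex_def .
  qed
  from choice[OF this] obtain f
    where f: "\<forall>w. f w \<in> range c \<and> iter Q (\<lambda>x. c x = f w) (Suc l) n (x(l := w))" ..
  obtain a where a: "Q l {w. f w = a}"
    using ultra_finite_range[OF assms(1) assms(2)] f by metis
  then have "Q l {w. iter Q (\<lambda>x. c x = a) (Suc l) n (x(l := w))}"
    by (rule ultra_mono[OF assms(1)]) (use f in auto)
  moreover have "{w. f w = a} \<noteq> {}" using a ultra_empty[OF assms(1)] by metis
  then have "a \<in> range c" using f by blast
  ultimately show ?case by auto
qed auto

text \<open>A type records the maxima of the blocks. Demanding zeros beyond the dummy index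
  \<open>m\<close> leaves finitely many types, so all can be treated at once.\<close>

definition types :: "nat \<Rightarrow> nat \<Rightarrow> (nat \<Rightarrow> nat) set" where
  "types m K = {js. (\<forall>s. js s \<le> K) \<and> (\<forall>s>m. js s = 0)}"

lemma finite_types: "finite (types m K)"
proof (rule finite_subset)
  show "types m K \<subseteq> {f. \<forall>s. (s \<in> {..m} \<longrightarrow> f s \<in> {..K}) \<and> (s \<notin> {..m} \<longrightarrow> f s = 0)}"
    by (auto simp: types_def)
qed (rule finite_set_of_finite_funs[OF finite_atMost finite_atMost])

text \<open>Canonical representatives of the tetris maps restricted to \<open>{0..K}\<close>. There
  are finitely many, and they act on functions bounded by \<open>K\<close> exactly as all tetris
  maps do.\<close>

definition tetris_upto :: "nat \<Rightarrow> (nat \<Rightarrow> nat) set" where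
  "tetris_upto K = {h. tetris h \<and> (\<forall>x\<ge>K. h x = h K)}"

lemma tetris_uptoD: "h \<in> tetris_upto K \<Longrightarrow> tetris h"
  unfolding tetris_upto_def by blast

lemma finite_tetris_upto: "finite (tetris_upto K)"
proof -
  define G :: "(nat \<Rightarrow> nat) set" where
    "G = {g. \<forall>x. (x \<in> {..K} \<longrightarrow> g x \<in> {..K}) \<and> (x \<notin> {..K} \<longrightarrow> g x = 0)}"
  have "finite G"
    unfolding G_def by (rule finite_set_of_finite_funs[OF finite_atMost finite_atMost])
  have "h \<in> (\<lambda>g x. g (min x K)) ` G" if h: "h \<in> tetris_upto K" for h
  proof (rule image_eqI)
    have "h x = h (min x K)" for x
    proof (cases "x \<le> K")
      case False
      then have "h x = h K" using h unfolding tetris_upto_def by (blast intro: less_imp_le dest: not_le_imp_less)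
      then show ?thesis using False by (simp add: min_absorb2)
    qed (simp add: min_absorb1)
    then show "h = (\<lambda>x. if min x K \<le> K then h (min x K) else 0)"
      unfolding fun_eq_iff by (simp only: min.cobounded2 if_True) blast
    have "h x \<le> K" if "x \<le> K" for x
      using tetris_le[OF tetris_uptoD[OF h], of x] that by simp
    then show "(\<lambda>x. if x \<le> K then h x else 0) \<in> G" by (simp add: G_def)
  qed
  then have "tetris_upto K \<subseteq> (\<lambda>g x. g (min x K)) ` G" by blast
  then show ?thesis by (rule finite_subset) (rule finite_imageI[OF \<open>finite G\<close>])
qed

lemma tetris_truncate:
  assumes "tetris h"
  shows "(\<lambda>x. h (min x K)) \<in> tetris_upto K"
proof -
  have "h (min (Suc x) K) = h (min x K) \<or> h (min (Suc x) K) = Suc (h (min x K))" for x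
  proof (cases "Suc x \<le> K")
    case True
    then show ?thesis using assms by (simp add: tetris_def min_absorb1)
  next
    case False
    then show ?thesis by (simp add: min_absorb2)
  qed
  then show ?thesis using assms by (simp add: tetris_upto_def tetris_def min_absorb2)
qed

text \<open>Stated over semilattices so that the same recursion produces both a block, at type
  \<open>nat \<Rightarrow> nat\<close>, and its maximum, at type \<open>nat\<close>.\<close>

fun block_sup :: "(nat \<Rightarrow> 'x::{semilattice_sup, order_bot}) \<Rightarrow> nat set \<Rightarrow> nat \<Rightarrow> 'x" where
  "block_sup g F 0 = bot"
| "block_sup g F (Suc n) = (if n \<in> F then sup (block_sup g F n) (g n) else block_sup g F n)"

lemma block_sup_bot: "F \<inter> {..<n} = {} \<Longrightarrow> block_sup g F n = bot"
  by (induction n) (auto simp: lessThan_Suc)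

lemma block_sup_least: "(\<And>e. e \<in> F \<Longrightarrow> g e \<le> a) \<Longrightarrow> block_sup g F n \<le> a"
  by (induction n) auto

lemma block_sup_upper: "e \<in> F \<Longrightarrow> e < n \<Longrightarrow> g e \<le> block_sup g F n"
  by (induction n) (auto simp: less_Suc_eq intro: le_supI1)

text \<open>In the application \<open>P js x\<close> says that \<open>x\<close> has the color assigned to the type \<open>js\<close>. A state
  \<open>(l, x, j)\<close> consists of the blocks built so far, where block \<open>l\<close> is still growing and all later
  blocks are empty, together with their types. One dummy block \<open>m\<close> is added after the blocks
  \<open>0, \<dots>, m - 1\<close>.\<close>

locale iterated_limits =
  fixes U :: "nat \<Rightarrow> (nat \<Rightarrow> nat) quant" and m K :: nat
    and P :: "(nat \<Rightarrow> nat) \<Rightarrow> (nat \<Rightarrow> nat \<Rightarrow> nat) \<Rightarrow> bool"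
  assumes U: "coherent U" "absorbing K U"
    and P: "\<And>js. js \<in> types m K \<Longrightarrow> iter (\<lambda>s. U (js s)) (P js) 0 (Suc m) bot"
begin

text \<open>The blocks before \<open>l\<close> are fixed with types \<open>j\<close>; whatever types
  the later blocks get, generic choices for them yield \<open>P\<close> for the completed
  type.\<close>

definition good :: "nat \<Rightarrow> (nat \<Rightarrow> nat \<Rightarrow> nat) \<Rightarrow> (nat \<Rightarrow> nat) \<Rightarrow> bool" where
  "good l x j \<longleftrightarrow>
     (\<forall>js \<in> types m K. (\<forall>s<l. js s = j s) \<longrightarrow> iter (\<lambda>s. U (js s)) (P js) l (Suc m - l) x)"

text \<open>The analogue of the star sets in the ultrafilter proof of Hindman's theorem: block
  \<open>l\<close> may be closed now, and it may also be closed after adding a generic element of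
  any maximum up to \<open>K\<close>.\<close>

definition star :: "nat \<Rightarrow> (nat \<Rightarrow> nat \<Rightarrow> nat) \<Rightarrow> (nat \<Rightarrow> nat) \<Rightarrow> bool" where
  "star l x j \<longleftrightarrow> good (Suc l) x j \<and>
     (\<forall>i\<le>K. U i {w. good (Suc l) (x(l := sup (x l) w)) (j(l := sup (j l) i))})"

lemma ultra_U: "ultra (U i)"
  using U(1) by (rule coherentD(1))

lemma good_next:
  assumes "good l x j" "l \<le> m"
  shows "U i {w. good (Suc l) (x(l := w)) (j(l := i))}"
proof -
  define J where "J = {js \<in> types m K. \<forall>s<Suc l. js s = (j(l := i)) s}"
  have "finite J" by (simp add: J_def finite_types)
  have "{w. good (Suc l) (x(l := w)) (j(l := i))} =
      {w. \<forall>js\<in>J. iter (\<lambda>s. U (js s)) (P js) (Suc l) (m - l) (x(l := w))}"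
    by (auto simp: good_def J_def)
  moreover have "U i {w. iter (\<lambda>s. U (js s)) (P js) (Suc l) (m - l) (x(l := w))}" if "js \<in> J" for js
  proof -
    have "js \<in> types m K" "\<forall>s<l. js s = j s" "js l = i"
      using that by (auto simp: J_def less_Suc_eq)
    moreover have "Suc m - l = Suc (m - l)" using \<open>l \<le> m\<close> by simp
    ultimately show ?thesis using assms(1) by (auto simp: good_def)
  qed
  ultimately show ?thesis
    using ultra_Ball[OF ultra_U \<open>finite J\<close>] by simp
qed

text \<open>An empty block \<open>l\<close> has maximum 0 and is generic for the principal
  \<open>U 0\<close>; adding \<open>w\<close> to it just puts \<open>w\<close> there.\<close>

lemma good_star:
  assumes "good l x j" "l \<le> m" "x l = bot" "j l = bot"
  shows "star l x j"
proof -
  have "U 0 {w. good (Suc l) (x(l := w)) (j(l := 0))}" using assms by (intro good_next)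
  then have "good (Suc l) (x(l := (\<lambda>_. 0))) (j(l := 0))" by (simp add: coherent_0[OF U(1)])
  moreover have "x(l := (\<lambda>_. 0)) = x" "j(l := 0) = j"
    using assms(3,4) by (auto simp: bot_fun_def bot_nat_def)
  ultimately show ?thesis
    using good_next[OF assms(1,2)] assms(3,4) by (simp add: star_def sup_absorb2)
qed

lemma star_later:
  assumes "star l x j" "\<And>s. s > l \<Longrightarrow> x s = bot \<and> j s = bot" "l \<le> l'" "l' \<le> m"
  shows "star l' x j"
  using assms(3,4)
proof (induction l' rule: dec_induct)
  case (step n)
  then show ?case using assms(2)[of "Suc n"] by (intro good_star) (auto simp: star_def)
qed (rule assms(1))

text \<open>Absorption enters here: \<open>U (sup i i')\<close> is the sum of \<open>U i\<close> and
  \<open>U i'\<close>, so adding a generic \<open>w'\<close> after a generic \<open>w\<close> is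
  covered by the hypothesis for maximum \<open>sup i i'\<close>.\<close>

lemma star_step:
  assumes "star l x j" "i \<le> K"
  shows "U i {w. star l (x(l := sup (x l) w)) (j(l := sup (j l) i))}"
proof -
  have "U i {w. U i' {w'. good (Suc l) (x(l := sup (sup (x l) w) w')) (j(l := sup (sup (j l) i) i'))}}"
    if "i' \<le> K" for i'
  proof -
    have "U (sup i i') = qsup (U i) (U i')"
      using U(2) assms(2) that by (cases "i \<le> i'") (auto simp: absorbing_def sup_max max_def)
    moreover have "U (sup i i') {w. good (Suc l) (x(l := sup (x l) w)) (j(l := sup (j l) (sup i i')))}"
      using assms that by (simp add: star_def)
    ultimately show ?thesis by (simp add: qsup_def sup.assoc)
  qed
  then have "U i {w. \<forall>i'\<in>{..K}. U i' {w'. good (Suc l) (x(l := sup (sup (x l) w) w')) (j(l := sup (sup (j l) i) i'))}}"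
    unfolding ultra_Ball[OF ultra_U finite_atMost] by simp
  moreover have "U i {w. good (Suc l) (x(l := sup (x l) w)) (j(l := sup (j l) i))}"
    using assms by (simp add: star_def)
  ultimately have "U i {w. good (Suc l) (x(l := sup (x l) w)) (j(l := sup (j l) i)) \<and>
      (\<forall>i'\<in>{..K}. U i' {w'. good (Suc l) (x(l := sup (sup (x l) w) w')) (j(l := sup (sup (j l) i) i'))})}"
    unfolding ultra_conj[OF ultra_U] by blast
  then show ?thesis by (simp add: star_def Ball_def)
qed

section \<open>Building the sequence from finite sets of states\<close>

definition valid :: "(nat \<times> (nat \<Rightarrow> nat \<Rightarrow> nat) \<times> (nat \<Rightarrow> nat)) set \<Rightarrow> bool" where
  "valid S \<longleftrightarrow> finite S \<and>
     (\<forall>(l, x, j) \<in> S. l \<le> m \<and> star l x j \<and> (\<forall>s>l. x s = bot \<and> j s = bot))"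

text \<open>All continuations by one new element at once: any image \<open>h \<circ> b\<close> joins
  block \<open>l\<close>, and then block \<open>l\<close> keeps growing or is closed in favor of a
  later \<open>l'\<close>. For \<open>b\<close> in \<open>peak K\<close> the maximum of
  \<open>h \<circ> b\<close> is \<open>h K\<close>, which is how the type grows; the zero map skips
  the element.\<close>

definition extend :: "(nat \<times> (nat \<Rightarrow> nat \<Rightarrow> nat) \<times> (nat \<Rightarrow> nat)) set \<Rightarrow> (nat \<Rightarrow> nat) \<Rightarrow>
    (nat \<times> (nat \<Rightarrow> nat \<Rightarrow> nat) \<times> (nat \<Rightarrow> nat)) set" where
  "extend S b = {(l', x(l := sup (x l) (h \<circ> b)), j(l := sup (j l) (h K))) |l' l x j h.
     (l, x, j) \<in> S \<and> h \<in> tetris_upto K \<and> l \<le> l' \<and> l' \<le> m}"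

lemma extendI:
  "(l, x, j) \<in> S \<Longrightarrow> h \<in> tetris_upto K \<Longrightarrow> l \<le> l' \<Longrightarrow> l' \<le> m \<Longrightarrow>
     (l', x(l := sup (x l) (h \<circ> b)), j(l := sup (j l) (h K))) \<in> extend S b"
  unfolding extend_def by blast

lemma valid_start: "valid ((\<lambda>l. (l, bot, bot)) ` {..m})"
proof -
  have "good 0 bot bot" using P by (simp add: good_def del: iter.simps)
  then have "star 0 bot bot" by (rule good_star) simp_all
  then have "star l bot bot" if "l \<le> m" for l by (rule star_later) (use that in simp_all)
  then show ?thesis by (auto simp: valid_def)
qed

text \<open>There are finitely many states and maps. For each, coherence pulls the large set of
  \<open>star_step\<close> at level \<open>h K\<close> back along \<open>h\<close> to a
  \<open>U K\<close>-large set of \<open>b\<close>, so a single \<open>b\<close> serves all of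
  them.\<close>

lemma valid_extend:
  assumes "valid S"
  shows "\<exists>b \<in> peak K. (\<forall>p. b p \<noteq> 0 \<longrightarrow> d < p) \<and> valid (extend S b)"
proof -
  have finS: "finite S" using assms by (simp add: valid_def)
  define A where "A = {b. \<forall>z\<in>S \<times> tetris_upto K. case z of ((l, x, j), h) \<Rightarrow>
      star l (x(l := sup (x l) (h \<circ> b))) (j(l := sup (j l) (h K)))}"
  have "U K A"
    unfolding A_def ultra_Ball[OF ultra_U finite_cartesian_product[OF finS finite_tetris_upto]]
  proof safe
    fix l x j h assume z: "(l, x, j) \<in> S" "h \<in> tetris_upto K"
    then have h: "tetris h" by (simp add: tetris_uptoD)
    have "star l x j" using z assms by (auto simp: valid_def)
    then have "U (h K) {w. star l (x(l := sup (x l) w)) (j(l := sup (j l) (h K)))}"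
      using tetris_le[OF h] by (intro star_step) auto
    then show "U K {b. star l (x(l := sup (x l) (h \<circ> b))) (j(l := sup (j l) (h K)))}"
      by (simp add: qmap_def flip: coherent_qmap[OF U(1) h])
  qed
  then have "U K (peak K \<inter> {x. \<forall>n\<le>d. x n = 0} \<inter> A)"
    using coherentD[OF U(1)] by (simp add: ultra_Int[OF ultra_U])
  then have "peak K \<inter> {x. \<forall>n\<le>d. x n = 0} \<inter> A \<noteq> {}"
    using ultra_empty[OF ultra_U] by metis
  then obtain b where b: "b \<in> peak K" "\<forall>n\<le>d. b n = 0" "b \<in> A" by blast
  have "extend S b \<subseteq> (\<lambda>(l', (l, x, j), h). (l', x(l := sup (x l) (h \<circ> b)), j(l := sup (j l) (h K)))) `
      ({..m} \<times> S \<times> tetris_upto K)"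
    by (force simp: extend_def)
  then have "finite (extend S b)"
    by (rule finite_subset) (intro finite_imageI finite_cartesian_product finS finite_tetris_upto finite_atMost)
  moreover have "l' \<le> m \<and> star l' x' j' \<and> (\<forall>s>l'. x' s = bot \<and> j' s = bot)"
    if "(l', x', j') \<in> extend S b" for l' x' j'
  proof -
    obtain l x j h where z: "(l, x, j) \<in> S" "h \<in> tetris_upto K" "l \<le> l'" "l' \<le> m"
      and x': "x' = x(l := sup (x l) (h \<circ> b))" and j': "j' = j(l := sup (j l) (h K))"
      using \<open>(l', x', j') \<in> extend S b\<close> unfolding extend_def by blast
    have "star l x' j'" using b(3) z unfolding A_def x' j' by fastforce
    moreover have tail: "x' s = bot \<and> j' s = bot" if "s > l" for s
      using z(1) assms that by (auto simp: valid_def x' j')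
    ultimately show ?thesis using star_later z(3,4) by auto
  qed
  ultimately have "valid (extend S b)" by (auto simp: valid_def)
  moreover have "d < p" if "b p \<noteq> 0" for p using b(2) that by (meson not_le)
  ultimately show ?thesis using b(1) by blast
qed

lemma ex_valid_sequence:
  "\<exists>b S. (\<forall>n. b n \<in> peak K \<and> (\<forall>p. b n p \<noteq> 0 \<longrightarrow> d n < p)) \<and>
     (\<forall>n p q. b n p \<noteq> 0 \<longrightarrow> b (Suc n) q \<noteq> 0 \<longrightarrow> p < q) \<and>
     S 0 = (\<lambda>l. (l, bot, bot)) ` {..m} \<and> (\<forall>n. S (Suc n) = extend (S n) (b n) \<and> valid (S n))"
proof -
  \<comment> \<open>The second component of \<open>z\<close> bounds the support chosen last and
    forces the next one beyond it.\<close>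
  let ?P = "\<lambda>(n :: nat) (z :: _ \<times> nat). valid (fst z) \<and> (n = 0 \<longrightarrow> fst z = (\<lambda>l. (l, bot, bot)) ` {..m})"
  let ?Q = "\<lambda>n z z'. \<exists>b \<in> peak K. fst z' = extend (fst z) b \<and>
      (\<forall>p. b p \<noteq> 0 \<longrightarrow> d n < p \<and> snd z < p \<and> p \<le> snd z')"
  have "\<exists>f. \<forall>n. ?P n (f n) \<and> ?Q n (f n) (f (Suc n))"
  proof (rule dependent_nat_choice[where P = ?P and Q = ?Q])
    show "\<exists>z. ?P 0 z"
      using valid_start by (intro exI[of _ "((\<lambda>l. (l, bot, bot)) ` {..m}, 0)"]) simp
  next
    fix z n assume "?P n z"
    then obtain b where b: "b \<in> peak K" "\<And>p. b p \<noteq> 0 \<Longrightarrow> max (d n) (snd z) < p" "valid (extend (fst z) b)"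
      using valid_extend[of "fst z" "max (d n) (snd z)"] by blast
    define z' where "z' = (extend (fst z) b, Max {p. b p \<noteq> 0})"
    have "finite {p. b p \<noteq> 0}" using b(1) by (simp add: peak_def)
    then have "p \<le> snd z'" if "b p \<noteq> 0" for p using that by (simp add: z'_def)
    then have "?Q n z z'"
      by (intro bexI[OF _ b(1)] conjI allI impI) (use b(2) in \<open>auto simp: z'_def\<close>)
    moreover have "?P (Suc n) z'" using b(3) by (simp add: z'_def)
    ultimately show "\<exists>z'. ?P (Suc n) z' \<and> ?Q n z z'" by blast
  qed
  then obtain f where f: "\<forall>n. ?P n (f n) \<and> ?Q n (f n) (f (Suc n))" ..
  then have "\<forall>n. \<exists>b. b \<in> peak K \<and> fst (f (Suc n)) = extend (fst (f n)) b \<and>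
      (\<forall>p. b p \<noteq> 0 \<longrightarrow> d n < p \<and> snd (f n) < p \<and> p \<le> snd (f (Suc n)))"
    unfolding Bex_def by simp
  from choice[OF this] obtain b where b: "\<And>n. b n \<in> peak K"
    "\<And>n. fst (f (Suc n)) = extend (fst (f n)) (b n)"
    "\<And>n p. b n p \<noteq> 0 \<Longrightarrow> d n < p \<and> snd (f n) < p \<and> p \<le> snd (f (Suc n))"
    by auto
  have "p < q" if "b n p \<noteq> 0" "b (Suc n) q \<noteq> 0" for n p q
    using b(3)[OF that(1)] b(3)[OF that(2)] by linarith
  then show ?thesis
    by (intro exI[of _ b] exI[of _ "fst \<circ> f"] conjI allI impI) (use b f in auto)
qed

text \<open>With \<open>l\<close> arbitrary, as long as no block after \<open>l\<close> has begun,
  the induction hypothesis applies to the block \<open>s\<close> that contains \<open>n\<close>;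
  after receiving its element that state moves on to \<open>l\<close>.\<close>

lemma reachable_states:
  assumes b: "\<And>n. b n \<in> peak K"
    and S: "S 0 = (\<lambda>l. (l, bot, bot)) ` {..m}" "\<And>n. S (Suc n) = extend (S n) (b n)"
    and F: "\<And>s s' a a'. s < s' \<Longrightarrow> a \<in> F s \<Longrightarrow> a' \<in> F s' \<Longrightarrow> a < a'" "\<And>s. s \<ge> m \<Longrightarrow> F s = {}"
    and h: "\<And>e. tetris (h e)"
    and l: "l \<le> m" "\<And>s. s > l \<Longrightarrow> F s \<inter> {..<n} = {}"
  shows "(l, \<lambda>s. block_sup (\<lambda>e. h e \<circ> b e) (F s) n, \<lambda>s. block_sup (\<lambda>e. h e K) (F s) n) \<in> S n"
  using l
proof (induction n arbitrary: l)
  case 0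
  then show ?case by (auto simp: S(1) bot_fun_def)
next
  case (Suc n)
  let ?x = "\<lambda>n s. block_sup (\<lambda>e. h e \<circ> b e) (F s) n"
  let ?j = "\<lambda>n s. block_sup (\<lambda>e. h e K) (F s) n"
  show ?case
  proof (cases "\<exists>s. n \<in> F s")
    case True
    then obtain s where s: "n \<in> F s" by blast
    have sl: "s \<le> l" by (rule ccontr) (use Suc.prems(2)[of s] s in auto)
    have "F s' \<inter> {..<n} = {}" if "s' > s" for s'
      using F(1)[OF that s] by fastforce
    then have IH: "(s, ?x n, ?j n) \<in> S n" by (intro Suc.IH) (use sl Suc.prems(1) in simp)
    have other: "n \<notin> F s'" if "s' \<noteq> s" for s'
      using F(1)[of s s' n n] F(1)[of s' s n n] s that by (meson less_irrefl linorder_neq_iff)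
    \<comment> \<open>\<open>extend\<close> admits truncated maps only; as \<open>b n\<close> is
      bounded by \<open>K\<close>, truncation does not change the composition.\<close>
    define g where "g = (\<lambda>x. h n (min x K))"
    have "g \<in> tetris_upto K" unfolding g_def by (rule tetris_truncate[OF h])
    moreover have "g \<circ> b n = h n \<circ> b n"
      using b[of n] by (auto simp: g_def peak_def fun_eq_iff)
    moreover have "g K = h n K" by (simp add: g_def)
    ultimately have "(l, (?x n)(s := sup (?x n s) (h n \<circ> b n)), (?j n)(s := sup (?j n s) (h n K)))
        \<in> S (Suc n)"
      using extendI[OF IH _ sl Suc.prems(1), of g "b n"] by (simp only: S(2))
    moreover have "(?x n)(s := sup (?x n s) (h n \<circ> b n)) = ?x (Suc n)"
      "(?j n)(s := sup (?j n s) (h n K)) = ?j (Suc n)"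
      using s other by (auto simp: fun_eq_iff)
    ultimately show ?thesis by (simp only:)
  next
    case False
    then have eq: "?x (Suc n) = ?x n" "?j (Suc n) = ?j n" by auto
    have IH: "(l, ?x n, ?j n) \<in> S n"
      by (rule Suc.IH) (use Suc.prems in \<open>auto simp: lessThan_Suc\<close>)
    \<comment> \<open>A position outside every block is passed over by the zero map.\<close>
    have zero: "(\<lambda>_. 0) \<in> tetris_upto K" by (simp add: tetris_upto_def tetris_def)
    have "(l, (?x n)(l := sup (?x n l) ((\<lambda>_. 0) \<circ> b n)), (?j n)(l := sup (?j n l) 0)) \<in> S (Suc n)"
      unfolding S(2) by (rule extendI[OF IH zero order_refl Suc.prems(1)])
    moreover have "(?x n)(l := sup (?x n l) ((\<lambda>_. 0) \<circ> b n)) = ?x n" "(?j n)(l := sup (?j n l) 0) = ?j n"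
      by (auto simp: fun_eq_iff sup_max)
    ultimately show ?thesis unfolding eq by (simp only:)
  qed
qed

end

section \<open>The Ramsey theorem for functions under tetris maps\<close>

theorem tetris_ramsey:
  fixes c :: "(nat \<Rightarrow> nat \<Rightarrow> nat) \<Rightarrow> 'c"
  assumes "finite (range c)"
  shows "\<exists>b \<chi>. (\<forall>n. b n \<in> peak K \<and> (\<forall>p. b n p \<noteq> 0 \<longrightarrow> d n < p)) \<and>
    (\<forall>n p q. b n p \<noteq> 0 \<longrightarrow> b (Suc n) q \<noteq> 0 \<longrightarrow> p < q) \<and>
    (\<forall>F h N. (\<forall>s s' a a'. s < s' \<longrightarrow> a \<in> F s \<longrightarrow> a' \<in> F s' \<longrightarrow> a < a') \<longrightarrow> (\<forall>s\<ge>m. F s = {}) \<longrightarrow>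
       (\<forall>e. tetris (h e)) \<longrightarrow>
       c (\<lambda>s. block_sup (\<lambda>e. h e \<circ> b e) (F s) N) = \<chi> (\<lambda>s. block_sup (\<lambda>e. h e K) (F s) N))"
proof -
  obtain U where U: "coherent U" "absorbing K U" using ex_coherent_absorbing by blast
  have "\<forall>js. \<exists>a. iter (\<lambda>s. U (js s)) (\<lambda>x. c x = a) 0 (Suc m) bot"
    using iter_finite_range[of "\<lambda>s. U (js s)" c for js, OF coherentD(1)[OF U(1)] assms] by blast
  then obtain \<chi> where \<chi>: "\<And>js. iter (\<lambda>s. U (js s)) (\<lambda>x. c x = \<chi> js) 0 (Suc m) bot" by metis
  interpret iterated_limits U m K "\<lambda>js x. c x = \<chi> js"
    by unfold_locales (rule U \<chi>)+
  obtain b S where b: "\<forall>n. b n \<in> peak K \<and> (\<forall>p. b n p \<noteq> 0 \<longrightarrow> d n < p)"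
      "\<forall>n p q. b n p \<noteq> 0 \<longrightarrow> b (Suc n) q \<noteq> 0 \<longrightarrow> p < q"
    and S: "S 0 = (\<lambda>l. (l, bot, bot)) ` {..m}" "\<forall>n. S (Suc n) = extend (S n) (b n) \<and> valid (S n)"
    using ex_valid_sequence[of d] by (elim exE conjE)
  have "c (\<lambda>s. block_sup (\<lambda>e. h e \<circ> b e) (F s) N) = \<chi> (\<lambda>s. block_sup (\<lambda>e. h e K) (F s) N)"
    if F: "\<forall>s s' a a'. s < s' \<longrightarrow> a \<in> F s \<longrightarrow> a' \<in> F s' \<longrightarrow> a < a'" "\<forall>s\<ge>m. F s = {}"
      and h: "\<forall>e. tetris (h e)" for F h N
  proof -
    let ?x = "\<lambda>s. block_sup (\<lambda>e. h e \<circ> b e) (F s) N"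
    let ?j = "\<lambda>s. block_sup (\<lambda>e. h e K) (F s) N"
    have "(m, ?x, ?j) \<in> S N"
      by (rule reachable_states[where b = b and S = S and F = F]) (use F h b(1) S in auto)
    \<comment> \<open>After \<open>Suc m\<close> blocks no quantifier is left, so
      \<open>good\<close> is the color equation itself.\<close>
    then have "good (Suc m) ?x ?j" using S(2) by (fastforce simp: valid_def star_def)
    moreover have "?j s \<le> K" for s by (rule block_sup_least) (use h tetris_le in auto)
    then have "?j \<in> types m K"
      using F(2) by (auto simp: types_def block_sup_bot bot_nat_def)
    ultimately show ?thesis by (simp add: good_def)
  qed
  with b show ?thesis by (intro exI[of _ b] exI[of _ \<chi>] conjI allI impI) blast+
qed

section \<open>Reduction of trees to paths\<close>

definition depth :: "'a rtree \<Rightarrow> 'a \<Rightarrow> nat" where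
  "depth T t = (LEAST n. (t, rtree.root T) \<in> parent T ^^ n)"

definition ancestor :: "'a rtree \<Rightarrow> 'a \<Rightarrow> nat \<Rightarrow> 'a" where
  "ancestor T t v = (THE u. tle T t u \<and> depth T u = v)"

text \<open>Values are depths along the path from \<open>t\<close> to the root. Depth 0 is the root,
  which lies outside \<open>plus_nodes T\<close>, so zeros become points outside the domain.\<close>

definition relabel :: "'a rtree \<Rightarrow> 'a \<Rightarrow> (nat \<Rightarrow> nat) \<Rightarrow> (nat \<rightharpoonup> 'a)" where
  "relabel T t x = (\<lambda>p. if x p = 0 then None else Some (ancestor T t (x p)))"

text \<open>The \<open>min\<close> extends the map constantly beyond the depth of \<open>t\<close>,
  to a tetris map on all of \<open>nat\<close>.\<close>

definition height_map :: "'a rtree \<Rightarrow> ('a \<Rightarrow> 'a) \<Rightarrow> 'a \<Rightarrow> nat \<Rightarrow> nat" where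
  "height_map T f t v = depth T (f (ancestor T t (min v (depth T t))))"

lemma tle_refl: "tle T t t"
  by (simp add: tle_def)

lemma tle_trans: "tle T t u \<Longrightarrow> tle T u v \<Longrightarrow> tle T t v"
  by (auto simp: tle_def)

context
  fixes T :: "'a rtree"
  assumes T: "finite_rooted_tree T"
begin

lemma parent_nodes: "(u, v) \<in> parent T \<Longrightarrow> u \<in> nodes T \<and> v \<in> nodes T"
  using T by (auto simp: finite_rooted_tree_def)

lemma root_node: "rtree.root T \<in> nodes T"
  using T by (simp add: finite_rooted_tree_def)

lemma tle_root: "t \<in> nodes T \<Longrightarrow> tle T t (rtree.root T)"
  using T by (simp add: finite_rooted_tree_def tle_def)

lemma single_valued_parent: "single_valued (parent T)"
proof (rule single_valuedI)
  fix u v w assume uv: "(u, v) \<in> parent T" and uw: "(u, w) \<in> parent T"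
  then have "u \<in> nodes T - {rtree.root T}"
    using T parent_nodes by (auto simp: finite_rooted_tree_def)
  then have "\<exists>!p. (u, p) \<in> parent T"
    using T unfolding finite_rooted_tree_def by blast
  with uv uw show "v = w" by blast
qed

lemma tle_nodes: "tle T t u \<Longrightarrow> t \<in> nodes T \<Longrightarrow> u \<in> nodes T"
  unfolding tle_def by (induction rule: rtrancl_induct) (auto dest: parent_nodes)

lemma depth_root: "depth T (rtree.root T) = 0"
  by (simp add: depth_def Least_eq_0)

lemma depth_child:
  assumes uv: "(u, v) \<in> parent T"
  shows "depth T u = Suc (depth T v)"
proof -
  have "(v, rtree.root T) \<in> (parent T)\<^sup>*"
    using tle_root parent_nodes[OF uv] by (auto simp: tle_def)
  then obtain n where "(v, rtree.root T) \<in> parent T ^^ n"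
    using rtrancl_imp_relpow by metis
  then have "(u, rtree.root T) \<in> parent T ^^ Suc n" using uv by (meson relpow_Suc_I2)
  moreover have "(u, rtree.root T) \<notin> parent T ^^ 0"
    using T uv by (auto simp: finite_rooted_tree_def)
  ultimately have "depth T u = Suc (LEAST n. (u, rtree.root T) \<in> parent T ^^ Suc n)"
    unfolding depth_def by (rule Least_Suc)
  moreover have "(u, rtree.root T) \<in> parent T ^^ Suc n \<longleftrightarrow> (v, rtree.root T) \<in> parent T ^^ n" for n
    using uv single_valuedD[OF single_valued_parent uv] relpow_Suc_D2 relpow_Suc_I2 by metis
  ultimately show ?thesis by (simp only: depth_def)
qed

lemma depth_tle: "tle T u v \<Longrightarrow> depth T v \<le> depth T u"
  unfolding tle_def by (induction rule: rtrancl_induct) (auto dest: depth_child)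

lemma tle_same_depth:
  assumes "tle T u v" "depth T u \<le> depth T v"
  shows "u = v"
proof (rule ccontr)
  assume "u \<noteq> v"
  then obtain w where w: "(u, w) \<in> parent T" "tle T w v"
    using assms(1) unfolding tle_def by (metis converse_rtranclE)
  with assms(2) show False using depth_child depth_tle by fastforce
qed

lemma tle_linear: "tle T t u \<Longrightarrow> tle T t v \<Longrightarrow> tle T u v \<or> tle T v u"
  unfolding tle_def by (rule single_valued_confluent[OF single_valued_parent])

lemma ancestor_depth:
  assumes "tle T t u"
  shows "ancestor T t (depth T u) = u"
  unfolding ancestor_def
proof (rule the_equality)
  fix v assume v: "tle T t v \<and> depth T v = depth T u"
  then consider "tle T v u" | "tle T u v" using tle_linear[OF assms, of v] by blast
  then show "v = u"
    by cases (use v tle_same_depth[of v u] tle_same_depth[of u v] in simp_all)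
qed (use assms in simp)

lemma ex_ancestor:
  assumes "t \<in> nodes T" "v \<le> depth T t"
  shows "\<exists>u. tle T t u \<and> depth T u = v"
proof -
  have "(t, rtree.root T) \<in> (parent T)\<^sup>*" using tle_root[OF assms(1)] by (simp add: tle_def)
  then show ?thesis using assms(2)
  proof (induction rule: converse_rtrancl_induct)
    case base
    then show ?case by (intro exI[of _ "rtree.root T"]) (simp add: tle_refl depth_root)
  next
    case (step y z)
    show ?case
    proof (cases "v \<le> depth T z")
      case True
      then obtain u where u: "tle T z u" "depth T u = v" using step.IH by blast
      have "tle T y z" using step.hyps(1) by (auto simp: tle_def)
      then have "tle T y u" using u(1) by (rule tle_trans)
      with u(2) show ?thesis by blast
    next
      case False
      then have "depth T y = v" using step.prems depth_child[OF step.hyps(1)] by simp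
      then show ?thesis by (intro exI[of _ y]) (simp add: tle_refl)
    qed
  qed
qed

lemma ancestor_props:
  assumes "t \<in> nodes T" "v \<le> depth T t"
  shows "tle T t (ancestor T t v)" "depth T (ancestor T t v) = v" "ancestor T t v \<in> nodes T"
proof -
  obtain u where u: "tle T t u" "depth T u = v" using ex_ancestor[OF assms] by blast
  then have "ancestor T t v = u" using ancestor_depth[OF u(1)] by simp
  then show "tle T t (ancestor T t v)" "depth T (ancestor T t v) = v" "ancestor T t v \<in> nodes T"
    using u tle_nodes[OF u(1) assms(1)] by simp_all
qed

lemma ancestor_self: "ancestor T t (depth T t) = t"
  using ancestor_depth[OF tle_refl] .

lemma ancestor_mono:
  assumes "t \<in> nodes T" "w \<le> depth T t" "v \<le> w"
  shows "tle T (ancestor T t w) (ancestor T t v)"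
proof -
  have v: "v \<le> depth T t" using assms by simp
  note V = ancestor_props[OF assms(1) v] and W = ancestor_props[OF assms(1,2)]
  show ?thesis
  proof (rule disjE[OF tle_linear[OF W(1) V(1)]])
    assume "tle T (ancestor T t v) (ancestor T t w)"
    then have "ancestor T t v = ancestor T t w" by (rule tle_same_depth) (simp add: V(2) W(2) assms(3))
    then show ?thesis by (simp add: tle_refl)
  qed
qed

lemma ancestor_upper:
  assumes "t \<in> nodes T" "tle T t u" "v \<le> depth T u"
  shows "ancestor T t v = ancestor T u v"
proof -
  have "u \<in> nodes T" using tle_nodes assms by blast
  note U = ancestor_props[OF this assms(3)]
  show ?thesis using ancestor_depth[OF tle_trans[OF assms(2) U(1)]] U(2) by simp
qed

lemma depth_eq_0:
  assumes "t \<in> nodes T"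
  shows "depth T t = 0 \<longleftrightarrow> t = rtree.root T"
  using tle_same_depth[OF tle_root[OF assms]] depth_root by auto

lemma plus_nodes_depth: "t \<in> nodes T \<Longrightarrow> t \<in> plus_nodes T \<longleftrightarrow> depth T t \<noteq> 0"
  by (simp add: plus_nodes_def depth_eq_0)

lemma ancestor_parent:
  assumes "t \<in> nodes T" "Suc v \<le> depth T t"
  shows "(ancestor T t (Suc v), ancestor T t v) \<in> parent T"
proof -
  have v: "v \<le> depth T t" using assms by simp
  let ?u = "ancestor T t (Suc v)" and ?w = "ancestor T t v"
  have tle: "tle T ?u ?w" using assms by (intro ancestor_mono) auto
  have d: "depth T ?u = Suc v" "depth T ?w = v" using ancestor_props assms v by auto
  then have "?u \<noteq> ?w" by auto
  then obtain z where z: "(?u, z) \<in> parent T" "tle T z ?w"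
    using tle unfolding tle_def by (metis converse_rtranclE)
  then have "z = ?w" using depth_child[OF z(1)] d by (intro tle_same_depth) auto
  with z(1) show ?thesis by simp
qed

section \<open>Regressive homomorphisms as tetris maps\<close>

context
  fixes f :: "'a \<Rightarrow> 'a" and t :: 'a
  assumes f: "regressive_hom T f" and t: "t \<in> nodes T"
begin

lemma hom_nodes: "u \<in> nodes T \<Longrightarrow> f u \<in> nodes T"
  using f by (auto simp: regressive_hom_def)

lemma hom_tle: "u \<in> nodes T \<Longrightarrow> tle T u (f u)"
  using f by (auto simp: regressive_hom_def)

text \<open>Since \<open>f\<close> moves nodes upwards, the image of an ancestor of \<open>t\<close>
  is again one, and its depth identifies it.\<close>

lemma hom_ancestor:
  assumes "v \<le> depth T t"
  shows "f (ancestor T t v) = ancestor T t (height_map T f t v)"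
    and "height_map T f t v = depth T (f (ancestor T t v))"
proof -
  note A = ancestor_props[OF t assms]
  show "height_map T f t v = depth T (f (ancestor T t v))"
    using assms by (simp add: height_map_def min_absorb1)
  then show "f (ancestor T t v) = ancestor T t (height_map T f t v)"
    using ancestor_depth[OF tle_trans[OF A(1) hom_tle[OF A(3)]]] by simp
qed

lemma height_map_depth: "height_map T f t (depth T t) = depth T (f t)"
  using hom_ancestor(2)[of "depth T t"] ancestor_self by simp

text \<open>Adjacency lets the depth of the image change by at most one along an edge, and order
  preservation excludes a decrease.\<close>

lemma tetris_height_map: "tetris (height_map T f t)"
  unfolding tetris_def
proof (intro conjI allI)
  have "ancestor T t 0 = rtree.root T" using ancestor_depth[OF tle_root[OF t]] depth_root by simp
  moreover have "depth T (f (rtree.root T)) = 0"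
    using depth_tle[OF hom_tle[OF root_node]] depth_root by simp
  ultimately show "height_map T f t 0 = 0" by (simp add: hom_ancestor(2))
next
  fix v
  show "height_map T f t (Suc v) = height_map T f t v \<or> height_map T f t (Suc v) = Suc (height_map T f t v)"
  proof (cases "Suc v \<le> depth T t")
    case True
    then have v: "v \<le> depth T t" by simp
    let ?u = "ancestor T t (Suc v)" and ?w = "ancestor T t v"
    have par: "(?u, ?w) \<in> parent T" using ancestor_parent[OF t True] .
    then have n: "?u \<in> nodes T" "?w \<in> nodes T" using parent_nodes by auto
    have "f ?u = f ?w \<or> adjacent T (f ?u) (f ?w)"
      using f n par unfolding regressive_hom_def adjacent_def by blast
    moreover have "tle T ?u ?w" using par by (auto simp: tle_def)
    then have "tle T (f ?u) (f ?w)"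
      using f n unfolding regressive_hom_def by blast
    then have "depth T (f ?w) \<le> depth T (f ?u)" by (rule depth_tle)
    ultimately have "depth T (f ?u) = depth T (f ?w) \<or> depth T (f ?u) = Suc (depth T (f ?w))"
      using depth_child by (fastforce simp: adjacent_def)
    then show ?thesis using hom_ancestor(2)[OF True] hom_ancestor(2)[OF v] by simp
  next
    case False
    then show ?thesis by (simp add: height_map_def min_absorb2)
  qed
qed

text \<open>\<open>f\<close> sends ancestors of \<open>t\<close> to ancestors of \<open>f t\<close>,
  and \<open>tau\<close> drops exactly the points whose new depth is 0.\<close>

lemma tau_relabel:
  assumes "\<And>p. x p \<le> depth T t"
  shows "tau T f (relabel T t x) = relabel T (f t) (height_map T f t \<circ> x)"
proof
  fix p
  let ?h = "height_map T f t"
  have "?h 0 = 0" using tetris_height_map by (simp add: tetris_def)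
  moreover have "f (ancestor T t (x p)) \<in> plus_nodes T \<longleftrightarrow> ?h (x p) \<noteq> 0"
    using plus_nodes_depth[OF hom_nodes[OF ancestor_props(3)[OF t assms]]] hom_ancestor(2)[OF assms] by simp
  moreover have "f (ancestor T t (x p)) = ancestor T (f t) (?h (x p))"
  proof -
    have "?h (x p) \<le> depth T (f t)"
      using monoD[OF tetris_mono[OF tetris_height_map] assms] height_map_depth by metis
    then show ?thesis
      using ancestor_upper[OF t hom_tle[OF t]] hom_ancestor(1)[OF assms] by simp
  qed
  ultimately show "tau T f (relabel T t x) p = relabel T (f t) (?h \<circ> x) p"
    by (cases "x p = 0") (simp_all add: tau_def relabel_def)
qed

end

section \<open>Relabelings as members of \<open>FIN\<close>\<close>

text \<open>Summands with different nodes \<open>u\<close> above a common \<open>t\<close> thus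
  become relabelings along one path, where they can be added.\<close>

lemma relabel_upper:
  assumes "t \<in> nodes T" "tle T t u" "\<And>p. x p \<le> depth T u"
  shows "relabel T u x = relabel T t x"
  using ancestor_upper[OF assms(1,2)] assms(3) by (simp add: relabel_def fun_eq_iff)

lemma ran_relabel:
  assumes "t \<in> nodes T" "\<And>p. x p \<le> depth T t"
  shows "ran (relabel T t x) \<subseteq> {u. tle T t u} \<inter> plus_nodes T"
proof
  fix u assume "u \<in> ran (relabel T t x)"
  then obtain p where p: "x p \<noteq> 0" "u = ancestor T t (x p)"
    by (auto simp: ran_def relabel_def split: if_splits)
  note A = ancestor_props[OF assms(1) assms(2)[of p]]
  with p show "u \<in> {u. tle T t u} \<inter> plus_nodes T" using plus_nodes_depth by auto
qed

lemma tchain_above: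
  assumes "t \<in> nodes T" "S \<subseteq> {u. tle T t u}"
  shows "tchain T S"
proof -
  have "S \<subseteq> nodes T" using assms tle_nodes by blast
  moreover have "tle T u v \<or> tle T v u" if "u \<in> S" "v \<in> S" for u v
    using that assms(2) tle_linear by blast
  ultimately show ?thesis unfolding tchain_def pred_on.chain_def by blast
qed

lemma tchain_branch:
  assumes "tchain T S"
  shows "\<exists>B. branch T B \<and> S \<subseteq> B"
proof -
  have fin: "finite {B. tchain T B \<and> S \<subseteq> B}"
  proof (rule finite_subset)
    show "{B. tchain T B \<and> S \<subseteq> B} \<subseteq> Pow (nodes T)"
      by (auto simp: tchain_def pred_on.chain_def)
    show "finite (Pow (nodes T))" using T by (simp add: finite_rooted_tree_def)
  qed
  obtain B where B: "tchain T B" "S \<subseteq> B"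
    and max: "\<And>B'. tchain T B' \<Longrightarrow> S \<subseteq> B' \<Longrightarrow> B \<subseteq> B' \<Longrightarrow> B = B'"
    using finite_has_maximal2[OF fin, of S] assms by auto
  have "branch T B"
    unfolding branch_def pred_on.maxchain_def
    using B max unfolding tchain_def by (metis order_trans psubset_eq)
  with B(2) show ?thesis by blast
qed

lemma relabel_FIN:
  assumes "t \<in> nodes T" "\<And>p. x p \<le> depth T t" "finite {p. x p \<noteq> 0}"
  shows "relabel T t x \<in> FIN T"
proof -
  have ran: "ran (relabel T t x) \<subseteq> {u. tle T t u} \<inter> plus_nodes T"
    by (rule ran_relabel) (use assms in auto)
  have "dom (relabel T t x) = {p. x p \<noteq> 0}" by (auto simp: relabel_def split: if_splits)
  moreover have "tchain T (ran (relabel T t x))"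
    using ran by (intro tchain_above[OF assms(1)]) auto
  then have "\<exists>B. branch T B \<and> ran (relabel T t x) \<subseteq> B" by (rule tchain_branch)
  ultimately show ?thesis using ran assms(3) by (auto simp: FIN_def)
qed

lemma relabel_FIN_at:
  assumes "t \<in> nodes T" "x \<in> peak (depth T t)"
  shows "relabel T t x \<in> FIN_at T t"
proof (cases "t = rtree.root T")
  case True
  then have "x = (\<lambda>_. 0)" using assms(2) by (simp add: depth_root peak_0)
  then show ?thesis using True by (simp add: FIN_at_def relabel_def)
next
  case False
  have x: "\<And>p. x p \<le> depth T t" "finite {p. x p \<noteq> 0}" using assms(2) by (auto simp: peak_def)
  have ran: "ran (relabel T t x) \<subseteq> {u. tle T t u} \<inter> plus_nodes T"
    by (rule ran_relabel) (use assms x in auto)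
  obtain p where p: "x p = depth T t" using assms(2) by (auto simp: peak_def)
  have "relabel T t x p = Some t"
    using p False depth_eq_0[OF assms(1)] ancestor_self by (simp add: relabel_def)
  then have "t \<in> ran (relabel T t x)" by (rule ranI)
  moreover have "tchain T (ran (relabel T t x))"
    using ran by (intro tchain_above[OF assms(1)]) auto
  ultimately have "chain_with_least T (ran (relabel T t x)) t"
    using ran by (auto simp: chain_with_least_def)
  then show ?thesis using False relabel_FIN[OF assms(1), of x] x by (simp add: FIN_at_def)
qed

end

section \<open>Sums of blocks\<close>

definition disjoint_supports :: "(nat \<Rightarrow> nat \<Rightarrow> nat) \<Rightarrow> nat set \<Rightarrow> bool" where
  "disjoint_supports y F \<longleftrightarrow> (\<forall>e\<in>F. \<forall>e'\<in>F. e \<noteq> e' \<longrightarrow> (\<forall>p. y e p = 0 \<or> y e' p = 0))"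

lemma disjoint_supportsD:
  "disjoint_supports y F \<Longrightarrow> e \<in> F \<Longrightarrow> e' \<in> F \<Longrightarrow> e \<noteq> e' \<Longrightarrow> y e p = 0 \<or> y e' p = 0"
  by (simp add: disjoint_supports_def)

text \<open>A pointwise description independent of order, linking the list recursion of
  \<open>fin_sum\<close> with the recursion of \<open>block_sup\<close>.\<close>

definition is_union :: "(nat \<Rightarrow> nat \<Rightarrow> nat) \<Rightarrow> nat set \<Rightarrow> (nat \<Rightarrow> nat) \<Rightarrow> bool" where
  "is_union y F z \<longleftrightarrow>
     (\<forall>p. (\<forall>e\<in>F. y e p \<noteq> 0 \<longrightarrow> z p = y e p) \<and> ((\<forall>e\<in>F. y e p = 0) \<longrightarrow> z p = 0))"

lemma fin_sum_list_relabel: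
  assumes "distinct es" "disjoint_supports y (set es)" "is_union y (set es) z"
  shows "fin_sum_list (map (\<lambda>e. relabel T t (y e)) es) = Some (relabel T t z)"
  using assms
proof (induction es arbitrary: z)
  case Nil
  then show ?case by (simp add: is_union_def relabel_def)
next
  case (Cons e es)
  \<comment> \<open>The function \<open>z\<close> with the support of the first summand erased,
    which is the union of the others.\<close>
  define z' where "z' = (\<lambda>p. if y e p \<noteq> 0 then 0 else z p)"
  have disj: "y e p = 0 \<or> y e' p = 0" if "e' \<in> set es" for e' p
  proof -
    have "e \<noteq> e'" using Cons.prems(1) that by auto
    then show ?thesis using that by (intro disjoint_supportsD[OF Cons.prems(2)]) simp_all
  qed
  have z: "z p = y e' p" if "e' \<in> set (e # es)" "y e' p \<noteq> 0" for e' p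
    using Cons.prems(3) that unfolding is_union_def by blast
  have z0: "z p = 0" if "\<forall>e'\<in>set (e # es). y e' p = 0" for p
    using Cons.prems(3) that unfolding is_union_def by blast
  have "is_union y (set es) z'"
    unfolding is_union_def
  proof (intro allI conjI ballI impI)
    fix p e' assume e': "e' \<in> set es" "y e' p \<noteq> 0"
    then show "z' p = y e' p" using disj[OF e'(1), of p] z[of e' p] by (simp add: z'_def)
  next
    fix p assume "\<forall>e'\<in>set es. y e' p = 0"
    then show "z' p = 0" using z0[of p] by (simp add: z'_def)
  qed
  moreover have "distinct es" "disjoint_supports y (set es)"
    using Cons.prems by (auto simp: disjoint_supports_def)
  ultimately have IH: "fin_sum_list (map (\<lambda>e. relabel T t (y e)) es) = Some (relabel T t z')"
    using Cons.IH by blast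
  have "dom (relabel T t (y e)) \<inter> dom (relabel T t z') = {}"
    by (auto simp: relabel_def z'_def split: if_splits)
  moreover have "relabel T t (y e) ++ relabel T t z' = relabel T t z"
  proof
    fix p
    show "(relabel T t (y e) ++ relabel T t z') p = relabel T t z p"
      using z[of e p] by (cases "y e p = 0") (simp_all add: relabel_def z'_def map_add_def)
  qed
  ultimately show ?case by (simp add: IH fin_add_def)
qed

text \<open>With disjoint supports at most one term is nonzero at each point, so maximum and union
  coincide.\<close>

lemma block_sup_union:
  assumes "disjoint_supports y F" "F \<subseteq> {..<N}"
  shows "is_union y F (block_sup y F N)"
proof -
  have "is_union y (F \<inter> {..<n}) (block_sup y F n)" for n
  proof (induction n)
    case 0
    then show ?case by (simp add: is_union_def bot_fun_def bot_nat_def)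
  next
    case (Suc n)
    show ?case
    proof (cases "n \<in> F")
      case True
      have IH: "block_sup y F n p = y e p" if "e \<in> F" "e < n" "y e p \<noteq> 0" for e p
        using Suc that unfolding is_union_def by blast
      have IH0: "block_sup y F n p = 0" if "\<forall>e\<in>F. e < n \<longrightarrow> y e p = 0" for p
        using Suc that unfolding is_union_def by blast
      have disj: "y e p = 0 \<or> y n p = 0" if "e \<in> F" "e < n" for e p
        by (rule disjoint_supportsD[OF assms(1) that(1) True]) (use that(2) in simp)
      have bs: "block_sup y F (Suc n) p = max (block_sup y F n p) (y n p)" for p
        by (simp only: block_sup.simps if_P[OF True] sup_fun_def sup_nat_def)
      show ?thesis
        unfolding is_union_def
      proof (intro allI conjI ballI impI)
        fix p e assume e: "e \<in> F \<inter> {..<Suc n}" "y e p \<noteq> 0"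
        show "block_sup y F (Suc n) p = y e p"
        proof (cases "e = n")
          case True
          have "\<forall>e'\<in>F. e' < n \<longrightarrow> y e' p = 0"
          proof (intro ballI impI)
            fix e' assume "e' \<in> F" "e' < n"
            then show "y e' p = 0" using disj[of e' p] e(2) True by simp
          qed
          then have "block_sup y F n p = 0" by (rule IH0)
          then show ?thesis using bs[of p] True by simp
        next
          case False
          then have "e \<in> F" "e < n" using e(1) by auto
          then show ?thesis using bs[of p] IH[of e p] disj[of e p] e(2) by simp
        qed
      next
        fix p assume "\<forall>e\<in>F \<inter> {..<Suc n}. y e p = 0"
        then show "block_sup y F (Suc n) p = 0" using bs[of p] IH0[of p] True by simp
      qed
    next
      case False
      then have "F \<inter> {..<Suc n} = F \<inter> {..<n}" by (auto simp: less_Suc_eq)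
      then show ?thesis using Suc False by simp
    qed
  qed
  moreover have "F \<inter> {..<N} = F" using assms(2) by blast
  ultimately show ?thesis by metis
qed

lemma fin_sum_relabel:
  assumes "finite F" "F \<subseteq> {..<N}" "disjoint_supports y F"
    and "\<And>e. e \<in> F \<Longrightarrow> g e = relabel T t (y e)"
  shows "fin_sum g F = Some (relabel T t (block_sup y F N))"
proof -
  have map: "map g (sorted_list_of_set F) = map (\<lambda>e. relabel T t (y e)) (sorted_list_of_set F)"
    using assms(1,4) by simp
  show ?thesis
    unfolding fin_sum_def map
    by (rule fin_sum_list_relabel) (use block_sup_union[OF assms(3,2)] assms(1,3) in simp_all)
qed

lemma finite_support_block_sup:
  assumes "\<And>e. finite {p. y e p \<noteq> (0::nat)}"
  shows "finite {p. block_sup y F n p \<noteq> 0}"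
proof (induction n)
  case 0
  then show ?case by (simp add: bot_fun_def bot_nat_def)
next
  case (Suc n)
  have "{p. block_sup y F (Suc n) p \<noteq> 0} \<subseteq> {p. block_sup y F n p \<noteq> 0} \<union> {p. y n p \<noteq> 0}"
    by (auto simp: sup_max)
  then show ?case by (rule finite_subset) (use Suc assms in simp)
qed

lemma tetris_minus: "tetris (\<lambda>x. x - a)"
  by (auto simp: tetris_def)

lemma block_seq_less:
  assumes F: "block_seq m F" and "s < s'" "s' < m" "a \<in> F s" "a' \<in> F s'"
  shows "a < a'"
proof -
  have step: "Max (F i) < x" if "Suc i < m" "x \<in> F (Suc i)" for i x
  proof -
    have "Max (F i) < Min (F (Suc i))" "finite (F (Suc i))" using F that unfolding block_seq_def by blast+
    then show ?thesis using Min_le[of "F (Suc i)" x] that by linarith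
  qed
  have fin: "finite (F i)" "F i \<noteq> {}" if "i < m" for i
    using F that unfolding block_seq_def by blast+
  have later: "\<forall>a'\<in>F (s + Suc n). a < a'" if "s + Suc n < m" for n
    using that
  proof (induction n)
    case 0
    have "a \<le> Max (F s)" using 0 assms(4) fin(1)[of s] by (intro Max_ge) simp_all
    with step[of s] 0 show ?case by (auto intro: le_less_trans)
  next
    case (Suc n)
    have i: "Suc (s + Suc n) < m" using Suc.prems by simp
    then have "Max (F (s + Suc n)) \<in> F (s + Suc n)" using fin[of "s + Suc n"] by (intro Max_in) simp_all
    then have "a < Max (F (s + Suc n))" using Suc.IH i by simp
    with step[OF i] show ?case using less_trans by fastforce
  qed
  obtain n where "s' = s + Suc n" using \<open>s < s'\<close> less_imp_Suc_add by auto
  then show ?thesis using later assms by blast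
qed

lemma support_less:
  fixes b :: "nat \<Rightarrow> nat \<Rightarrow> nat"
  assumes b: "\<And>n. b n \<in> peak K" "\<And>n p q. b n p \<noteq> 0 \<Longrightarrow> b (Suc n) q \<noteq> 0 \<Longrightarrow> p < q"
    and "n < n'" "b n p \<noteq> 0" "b n' q \<noteq> 0"
  shows "p < q"
  using assms(3,5)
proof (induction n' arbitrary: q)
  case (Suc n')
  show ?case
  proof (cases "n = n'")
    case True
    then show ?thesis using Suc.prems(2) assms(4) b(2) by blast
  next
    case False
    have "b n p \<le> K" using b(1)[of n] by (simp add: peak_def)
    \<comment> \<open>A zero \<open>K\<close> would make every \<open>b n\<close> vanish. Hence the
      intermediate function \<open>b n'\<close> has a support point \<open>r\<close>, through which
      the comparison passes.\<close>
    then have "K \<noteq> 0" using assms(4) by simp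
    moreover obtain r where "b n' r = K" using b(1)[of n'] by (auto simp: peak_def)
    ultimately have r: "b n' r \<noteq> 0" by simp
    have "n < n'" using False Suc.prems(1) by simp
    then have "p < r" using Suc.IH r by blast
    also have "r < q" using b(2) r Suc.prems(2) by blast
    finally show ?thesis .
  qed
qed simp

theorem theorem4p2:
  fixes m k :: nat
    and lam :: "nat \<Rightarrow> nat"
    and T :: "nat \<Rightarrow> 'a rtree"
    and c :: "(nat \<Rightarrow> (nat \<rightharpoonup> 'a)) \<Rightarrow> 'c"
    and C :: "'c set"
    and d :: "nat \<Rightarrow> nat"
  assumes "lam \<in> {..<m} \<rightarrow> {..<k}"
    and "\<And>i. i < k \<Longrightarrow> finite_rooted_tree (T i)"
    and "finite C"
    and "c \<in> (\<Pi>\<^sub>E s\<in>{..<m}. FIN (T (lam s))) \<rightarrow> C"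
  shows "\<exists>b :: nat \<Rightarrow> 'a \<Rightarrow> nat \<Rightarrow> (nat \<rightharpoonup> 'a).
    (\<forall>i<k. \<forall>t\<in>nodes (T i). \<forall>n. b i t n \<in> FIN_at (T i) t) \<and>
    (\<forall>i<k. \<forall>t\<in>nodes (T i). \<forall>n.
       set_gt_nat (dom (b i t n)) (d n) \<and> set_gt (dom (b i t (Suc n))) (dom (b i t n))) \<and>
    (\<exists>\<chi> :: (nat \<Rightarrow> 'a) \<Rightarrow> 'c.
       \<forall>(F :: nat \<Rightarrow> nat set) (t :: nat \<Rightarrow> nat \<Rightarrow> 'a) (f :: nat \<Rightarrow> nat \<Rightarrow> 'a \<Rightarrow> 'a) (ts :: nat \<Rightarrow> 'a).
         block_seq m F \<longrightarrow>
         (\<forall>i<k. \<forall>e. t i e \<in> nodes (T i) \<and> regressive_hom (T i) (f i e)) \<longrightarrow>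
         (\<forall>s<m. chain_with_least (T (lam s))
                  ((\<lambda>e. f (lam s) e (t (lam s) e)) ` F s) (ts s)) \<longrightarrow>
         (\<exists>x \<in> (\<Pi>\<^sub>E s\<in>{..<m}. FIN (T (lam s))).
            (\<forall>s<m. fin_sum (\<lambda>e. tau (T (lam s)) (f (lam s) e)
                                   (b (lam s) (t (lam s) e) e)) (F s) = Some (x s)) \<and>
            c x = \<chi> (restrict ts {..<m})))"
proof -
  note T = assms(2)
  have lam: "lam s < k" if "s < m" for s using assms(1) that by auto
  have T_lam: "finite_rooted_tree (T (lam s))" if "s < m" for s using T lam that by blast
  have finT: "finite (nodes (T i))" if "i < k" for i
    using T[OF that] by (simp add: finite_rooted_tree_def)
  define K where "K = Max (insert 0 (\<Union>i<k. depth (T i) ` nodes (T i)))"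
  have K: "depth (T i) u \<le> K" if "i < k" "u \<in> nodes (T i)" for i u
    unfolding K_def using finT that by (intro Max_ge) auto
  \<comment> \<open>Truncated subtraction lowers the maximum \<open>K\<close> to the depth of
    \<open>u\<close>, so one sequence of functions serves all trees and nodes.\<close>
  define low where "low i u = (\<lambda>x. x - (K - depth (T i) u))" for i u
  have low: "tetris (low i u)" "low i u K = depth (T i) u" if "i < k" "u \<in> nodes (T i)" for i u
    unfolding low_def by (rule tetris_minus) (use K[OF that] in simp)
  define TS where "TS = (\<Pi>\<^sub>E s\<in>{..<m}. nodes (T (lam s)))"
  have "finite TS" unfolding TS_def using finT lam by (intro finite_PiE) auto
  define tuple where "tuple ts x = (\<lambda>s\<in>{..<m}. relabel (T (lam s)) (ts s) (x s))" for ts x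
  \<comment> \<open>The table of colors of all relabelings. An entry is \<open>undefined\<close>
    when the color is outside \<open>C\<close>, as may happen for tuples outside the domain of the
    coloring; this keeps the range finite.\<close>
  define c' where "c' x = (\<lambda>ts\<in>TS. if c (tuple ts x) \<in> C then c (tuple ts x) else undefined)" for x
  have "range c' \<subseteq> (\<Pi>\<^sub>E ts\<in>TS. insert undefined C)" by (auto simp: c'_def)
  then have "finite (range c')"
    by (rule finite_subset) (use \<open>finite TS\<close> assms(3) in \<open>simp add: finite_PiE\<close>)
  from tetris_ramsey[OF this, of K d m] obtain b \<chi> where
    b1: "\<forall>n. b n \<in> peak K \<and> (\<forall>p. b n p \<noteq> 0 \<longrightarrow> d n < p)" and
    b2: "\<forall>n p q. b n p \<noteq> 0 \<longrightarrow> b (Suc n) q \<noteq> 0 \<longrightarrow> p < q" and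
    \<chi>: "\<forall>F h N. (\<forall>s s' a a'. s < s' \<longrightarrow> a \<in> F s \<longrightarrow> a' \<in> F s' \<longrightarrow> a < a') \<longrightarrow> (\<forall>s\<ge>m. F s = {}) \<longrightarrow>
       (\<forall>e. tetris (h e)) \<longrightarrow>
       c' (\<lambda>s. block_sup (\<lambda>e. h e \<circ> b e) (F s) N) = \<chi> (\<lambda>s. block_sup (\<lambda>e. h e K) (F s) N)"
    by (elim exE conjE)
  have bK: "b n p \<le> K" for n p using b1 by (simp add: peak_def)
  define B where "B i u n = relabel (T i) u (low i u \<circ> b n)" for i u n
  have low_peak: "low i u \<circ> b n \<in> peak (depth (T i) u)" if "i < k" "u \<in> nodes (T i)" for i u n
    using peak_comp[OF low(1)[OF that], of "b n" K] b1 low(2)[OF that] by simp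
  have dom_B: "b n p \<noteq> 0" if "p \<in> dom (B i u n)" for i u n p
    using that by (auto simp: B_def relabel_def low_def split: if_splits)
  have B_FIN: "B i u n \<in> FIN_at (T i) u" if "i < k" "u \<in> nodes (T i)" for i u n
    unfolding B_def by (rule relabel_FIN_at[OF T[OF that(1)] that(2) low_peak[OF that]])
  have B_gt: "set_gt_nat (dom (B i u n)) (d n)" for i u n
    unfolding set_gt_nat_def using dom_B b1 by blast
  have B_increasing: "set_gt (dom (B i u (Suc n))) (dom (B i u n))" for i u n
    unfolding set_gt_def using dom_B b2 by blast
  \<comment> \<open>The type given by the depths of the \<open>ts s\<close> selects a table, and
    \<open>ts\<close> selects its entry, so only \<open>ts\<close> matters.\<close>
  define col where "col ts = \<chi> (\<lambda>s. if s < m then depth (T (lam s)) (ts s) else 0) ts" for ts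
  have B_color: "\<exists>x \<in> (\<Pi>\<^sub>E s\<in>{..<m}. FIN (T (lam s))).
      (\<forall>s<m. fin_sum (\<lambda>e. tau (T (lam s)) (f (lam s) e) (B (lam s) (t (lam s) e) e)) (F s) = Some (x s)) \<and>
      c x = col (restrict ts {..<m})"
    if F: "block_seq m F"
      and tf: "\<forall>i<k. \<forall>e. t i e \<in> nodes (T i) \<and> regressive_hom (T i) (f i e)"
      and ts: "\<forall>s<m. chain_with_least (T (lam s)) ((\<lambda>e. f (lam s) e (t (lam s) e)) ` F s) (ts s)"
    for F t f ts
  proof -
    have t: "t (lam s) e \<in> nodes (T (lam s))" and f: "regressive_hom (T (lam s)) (f (lam s) e)"
      if "s < m" for s e
      using tf lam[OF that] by blast+
    let ?ft = "\<lambda>s e. f (lam s) e (t (lam s) e)"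
    have ft: "?ft s e \<in> nodes (T (lam s))" if "s < m" for s e
      using f[OF that] t[OF that] unfolding regressive_hom_def by blast
    have ts_in: "ts s \<in> ?ft s ` F s" if "s < m" for s
      using ts that unfolding chain_with_least_def by blast
    have ts_le: "tle (T (lam s)) (ts s) (?ft s e)" if "s < m" "e \<in> F s" for s e
      using ts that unfolding chain_with_least_def by blast
    have ts_node: "ts s \<in> nodes (T (lam s))" if "s < m" for s
      using ts_in[OF that] ft[OF that] by auto
    have finF: "finite (F s)" if "s < m" for s using F that by (simp add: block_seq_def)
    then have "finite (\<Union>s<m. F s)" by simp
    then obtain N where N: "(\<Union>s<m. F s) \<subseteq> {..<N}" using finite_nat_iff_bounded by blast
    \<comment> \<open>\<open>F s\<close> is arbitrary for \<open>s \<ge> m\<close>, where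
      \<open>tetris_ramsey\<close> asks for empty sets.\<close>
    define G where "G s = (if s < m then F s else {})" for s
    have G: "a < a'" if "s < s'" "a \<in> G s" "a' \<in> G s'" for s s' a a'
      using block_seq_less[OF F, of s s' a a'] that by (simp add: G_def split: if_splits)
    \<comment> \<open>The map in \<open>tetris_ramsey\<close> depends on \<open>e\<close> alone;
      each \<open>e\<close> lies in at most one block, whose index selects the tree and the
      homomorphism. When the index is not below \<open>m\<close>, \<open>h\<close> falls back to the
      identity.\<close>
    define block where "block e = (SOME s. e \<in> G s)" for e
    have block: "block e = s" if "e \<in> G s" for e s
    proof -
      have "e \<in> G (block e)" unfolding block_def using that by (rule someI)
      then show ?thesis using G[of s "block e" e e] G[of "block e" s e e] that
        by (meson less_irrefl linorder_neq_iff)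
    qed
    define h where "h e = (let s = block e in
        if s < m then height_map (T (lam s)) (f (lam s) e) (t (lam s) e) \<circ> low (lam s) (t (lam s) e)
        else (\<lambda>x. x - 0))" for e
    have h_tetris: "tetris (h e)" for e
    proof (cases "block e < m")
      case True
      then show ?thesis
        unfolding h_def Let_def
        using tetris_comp[OF tetris_height_map[OF T_lam f t] low(1)[OF lam t]] by simp
    next
      case False
      then show ?thesis unfolding h_def Let_def using tetris_minus[of 0] by simp
    qed
    have h_eq: "h e = height_map (T (lam s)) (f (lam s) e) (t (lam s) e) \<circ> low (lam s) (t (lam s) e)"
      if "s < m" "e \<in> F s" for s e
      using that block[of e s] by (simp add: h_def G_def)
    have h_K: "h e K = depth (T (lam s)) (?ft s e)" if "s < m" "e \<in> F s" for s e
      using h_eq[OF that] low(2)[OF lam t] height_map_depth[OF T_lam f t] that(1) by simp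
    define x where "x s = block_sup (\<lambda>e. h e \<circ> b e) (G s) N" for s
    \<comment> \<open>The least node of the chain is the deepest, so the maximum over the block is
      its depth.\<close>
    have type: "block_sup (\<lambda>e. h e K) (G s) N = (if s < m then depth (T (lam s)) (ts s) else 0)" for s
    proof (cases "s < m")
      case True
      have "block_sup (\<lambda>e. h e K) (G s) N \<le> depth (T (lam s)) (ts s)"
      proof (rule block_sup_least)
        fix e assume "e \<in> G s"
        then have e: "e \<in> F s" using True by (simp add: G_def)
        show "h e K \<le> depth (T (lam s)) (ts s)"
          unfolding h_K[OF True e] by (rule depth_tle[OF T_lam[OF True] ts_le[OF True e]])
      qed
      moreover obtain e where e: "e \<in> F s" "ts s = ?ft s e" using ts_in[OF True] by (elim imageE)
      then have "h e K \<le> block_sup (\<lambda>e. h e K) (G s) N"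
        using N True by (intro block_sup_upper[where g = "\<lambda>e. h e K"]) (auto simp: G_def)
      then have "depth (T (lam s)) (ts s) \<le> block_sup (\<lambda>e. h e K) (G s) N"
        using h_K[OF True e(1)] e(2) by simp
      ultimately show ?thesis using True by simp
    next
      case False
      then show ?thesis by (simp add: G_def block_sup_bot bot_nat_def)
    qed
    have x_le: "x s p \<le> depth (T (lam s)) (ts s)" if "s < m" for s p
    proof -
      have "x s \<le> (\<lambda>_. block_sup (\<lambda>e. h e K) (G s) N)"
        unfolding x_def
      proof (rule block_sup_least)
        fix e assume e: "e \<in> G s"
        have "e < N" using N e that by (auto simp: G_def)
        then have "h e K \<le> block_sup (\<lambda>e. h e K) (G s) N"
          by (rule block_sup_upper[where g = "\<lambda>e. h e K", OF e])
        moreover have "h e (b e p) \<le> h e K" for p by (rule monoD[OF tetris_mono[OF h_tetris] bK])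
        ultimately show "h e \<circ> b e \<le> (\<lambda>_. block_sup (\<lambda>e. h e K) (G s) N)"
          unfolding le_fun_def comp_def using le_trans by blast
      qed
      then show ?thesis using type[of s] that by (simp add: le_fun_def)
    qed
    have h0: "h e 0 = 0" for e using h_tetris[of e] by (simp add: tetris_def)
    have h_supp: "b e p \<noteq> 0" if "(h e \<circ> b e) p \<noteq> 0" for e p
      using that h0[of e] by (metis comp_apply)
    have x_fin: "finite {p. x s p \<noteq> 0}" for s
      unfolding x_def
    proof (rule finite_support_block_sup)
      fix e
      have "finite {p. b e p \<noteq> 0}" using b1 by (simp add: peak_def)
      then show "finite {p. (h e \<circ> b e) p \<noteq> 0}" by (rule finite_subset[rotated]) (use h_supp in blast)
    qed
    have disj: "disjoint_supports (\<lambda>e. h e \<circ> b e) A" for A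
      unfolding disjoint_supports_def
    proof (intro ballI impI allI)
      fix e e' :: nat and p assume "e \<noteq> e'"
      have less: False if "e < e'" "b e p \<noteq> 0" "b e' p \<noteq> 0" for e e'
        using support_less[of b K e e' p p] b1 b2 that by blast
      show "(h e \<circ> b e) p = 0 \<or> (h e' \<circ> b e') p = 0"
        using less[of e e'] less[of e' e] h_supp[of e p] h_supp[of e' p] \<open>e \<noteq> e'\<close>
        by (meson linorder_neq_iff)
    qed
    have sum: "fin_sum (\<lambda>e. tau (T (lam s)) (f (lam s) e) (B (lam s) (t (lam s) e) e)) (F s) =
        Some (relabel (T (lam s)) (ts s) (x s))" if s: "s < m" for s
    proof -
      have summand: "tau (T (lam s)) (f (lam s) e) (B (lam s) (t (lam s) e) e) =
          relabel (T (lam s)) (ts s) (h e \<circ> b e)" if e: "e \<in> F s" for e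
      proof -
        have y: "(low (lam s) (t (lam s) e) \<circ> b e) p \<le> depth (T (lam s)) (t (lam s) e)" for p
          using low_peak[OF lam[OF s] t[OF s], of e e] by (simp add: peak_def)
        have "tau (T (lam s)) (f (lam s) e) (B (lam s) (t (lam s) e) e) =
            relabel (T (lam s)) (?ft s e)
              (height_map (T (lam s)) (f (lam s) e) (t (lam s) e) \<circ> (low (lam s) (t (lam s) e) \<circ> b e))"
          unfolding B_def by (rule tau_relabel[OF T_lam[OF s] f[OF s] t[OF s] y])
        also have "\<dots> = relabel (T (lam s)) (?ft s e) (h e \<circ> b e)"
          by (simp only: h_eq[OF s e] comp_assoc)
        also have "\<dots> = relabel (T (lam s)) (ts s) (h e \<circ> b e)"
        proof (rule relabel_upper[OF T_lam[OF s] ts_node[OF s] ts_le[OF s e]])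
          show "(h e \<circ> b e) p \<le> depth (T (lam s)) (?ft s e)" for p
            using monoD[OF tetris_mono[OF h_tetris[of e]] bK] h_K[OF s e] by simp
        qed
        finally show ?thesis .
      qed
      have "fin_sum (\<lambda>e. tau (T (lam s)) (f (lam s) e) (B (lam s) (t (lam s) e) e)) (F s) =
          Some (relabel (T (lam s)) (ts s) (block_sup (\<lambda>e. h e \<circ> b e) (F s) N))"
        by (rule fin_sum_relabel[OF finF[OF s] _ disj summand]) (use N s in blast)
      then show ?thesis using s by (simp only: x_def G_def if_True)
    qed
    have x_eq: "x = (\<lambda>s. block_sup (\<lambda>e. h e \<circ> b e) (G s) N)"
      by (rule ext) (rule x_def)
    define ts' where "ts' = restrict ts {..<m}"
    have "ts' \<in> TS" using ts_node by (simp add: ts'_def TS_def)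
    have tuple_ts': "tuple ts' x = (\<lambda>s\<in>{..<m}. relabel (T (lam s)) (ts s) (x s))"
      by (auto simp: tuple_def ts'_def)
    have "relabel (T (lam s)) (ts s) (x s) \<in> FIN (T (lam s))" if "s < m" for s
      by (rule relabel_FIN[OF T_lam[OF that] ts_node[OF that] x_le[OF that] x_fin])
    then have tuple_FIN: "tuple ts' x \<in> (\<Pi>\<^sub>E s\<in>{..<m}. FIN (T (lam s)))"
      unfolding tuple_ts' by (simp add: restrict_PiE_iff)
    then have "c (tuple ts' x) \<in> C" using assms(4) by blast
    then have "c (tuple ts' x) = c' x ts'" using \<open>ts' \<in> TS\<close> by (simp add: c'_def)
    also have "c' x = \<chi> (\<lambda>s. block_sup (\<lambda>e. h e K) (G s) N)"
      unfolding x_eq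
    proof (rule \<chi>[rule_format])
      show "a < a'" if "s < s'" "a \<in> G s" "a' \<in> G s'" for s s' a a' using that by (rule G)
      show "G s = {}" if "m \<le> s" for s using that by (simp add: G_def)
      show "tetris (h e)" for e by (rule h_tetris)
    qed
    also have "(\<lambda>s. block_sup (\<lambda>e. h e K) (G s) N) = (\<lambda>s. if s < m then depth (T (lam s)) (ts' s) else 0)"
      using type by (simp add: ts'_def fun_eq_iff)
    finally have "c (tuple ts' x) = col (restrict ts {..<m})"
      by (simp only: col_def ts'_def)
    with tuple_FIN sum show ?thesis
      by (intro bexI[of _ "tuple ts' x"]) (simp_all add: tuple_ts')
  qed
  show ?thesis
  proof (rule exI[of _ B], intro conjI)
    show "\<forall>i<k. \<forall>u\<in>nodes (T i). \<forall>n. B i u n \<in> FIN_at (T i) u"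
      using B_FIN by blast
    show "\<forall>i<k. \<forall>u\<in>nodes (T i). \<forall>n.
        set_gt_nat (dom (B i u n)) (d n) \<and> set_gt (dom (B i u (Suc n))) (dom (B i u n))"
      using B_gt B_increasing by simp
  qed (rule exI[of _ col], intro allI impI, rule B_color)
qed

end
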